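(* For every $d\in\mathbb{N}$ let $C_\gamma\ge\gamma_{d,1}\ge\cdots\ge\gamma_{d,d}>0$ ($C_\gamma$ independent of $d$) be generators of product weights $\gamma_{\boldsymbol\alpha}=\prod_{j=1}^d(\gamma_{d,j})^{\alpha_j}$, and let $(\mathcal{F}_d^\gamma)_{d\in\mathbb{N}}$ be a sequence of Banach spaces of real-valued functions on $[0,1]^d$. Assume that there are absolute constants $c,q_1\ge0$ such that for all $d\in\mathbb{N}$ the space $\mathcal{P}_d^\gamma$ is continuously embedded into $\mathcal{F}_d^\gamma$ with embedding norm $C_{1,d}\le c\cdot d^{q_1}$. Consider the uniform approximation problem $\mathrm{App}=(\mathrm{App}_d)_{d\in\mathbb{N}}$, $\mathrm{App}_d\colon\mathcal{F}_d^\gamma\to L_\infty([0,1]^d)$, $\mathrm{App}_d(f)=f$, in the worst case setting with respect to the class $\mathcal{A}_d^{n,\mathrm{cont}}\cup\mathcal{A}_d^{n,\mathrm{adapt}}$ of algorithms and the absolute error criterion. Then $$n^{\mathrm{wor}}(\varepsilon,d;\mathrm{App}_d)>\frac12\cdot2^{\frac1{2+C_\gamma}\sum_{j=1}^d\gamma_{d,j}}$$ for all $d\in\mathbb{N}$ and every $\varepsilon\in(0,C_{1,d}^{-1})$. Hence, - if the problem $\mathrm{App}$ is polynomially tractable then $q(\gamma)\le1$, - if $q_1=0$ and the problem is strongly polynomially tractable then $p(\gamma)\le1$.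
   Context: $\mathcal{P}_d^\gamma$ is the linear span of the monomials $\boldsymbol x\mapsto\boldsymbol x^{\boldsymbol i}$, $\boldsymbol i\in\{0,1\}^d$, on $[0,1]^d$, normed by $\|f\mid\mathcal{P}_d^\gamma\|=\max_{\boldsymbol\alpha\in\{0,1\}^d}\frac1{\gamma_{\boldsymbol\alpha}}\|D^{\boldsymbol\alpha}f\mid L_\infty([0,1]^d)\|$. The spaces $\mathcal{F}_d^\gamma$ are such that $\mathrm{App}_d$ is well-defined, i.e. $\mathcal{F}_d^\gamma\subseteq L_\infty([0,1]^d)$. Sum exponents: $p(\gamma)=\inf\{\kappa\ge0\mid\limsup_{d\to\infty}\sum_{j=1}^d(\gamma_{d,j})^\kappa<\infty\}$, $q(\gamma)=\inf\{\kappa\ge0\mid\limsup_{d\to\infty}\sum_{j=1}^d(\gamma_{d,j})^\kappa/\ln(d+1)<\infty\}$, $\inf\emptyset=\infty$. Algorithms: elements of $\mathcal{A}_d^{n,\mathrm{cont}}\cup\mathcal{A}_d^{n,\mathrm{adapt}}$ are maps $A=\varphi\circ N$ with arbitrary $\varphi\colon\mathbb{R}^n\to L_\infty([0,1]^d)$ and either (cont) $N(f)=(L_1(f),\dots,L_n(f))$ with continuous, not necessarily linear, $L_j\colon\mathcal{F}_d^\gamma\to\mathbb{R}$, or (adapt) $N(f)=(y_1,\dots,y_n)$ with $y_1=L_1(f)$, $y_j=L_j(f;y_1,\dots,y_{j-1})$ and each $L_j(\cdot\,;y_1,\dots,y_{j-1})$ a continuous linear functional on $\mathcal{F}_d^\gamma$;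 for $n=0$ constant maps. $e(n,d)=\inf_A\sup_{\|f\mid\mathcal{F}_d^\gamma\|\le1}\|f-Af\mid L_\infty([0,1]^d)\|$ over this class, and $n^{\mathrm{wor}}(\varepsilon,d;\mathrm{App}_d)=\min\{n\in\mathbb{N}_0\mid e(n,d)\le\varepsilon\}$ ($=\infty$ if there is no such $n$). Polynomial tractability: there are $C,p>0$, $q\ge0$ with $n^{\mathrm{wor}}(\varepsilon,d;\mathrm{App}_d)\le C\varepsilon^{-p}d^q$ for all $\varepsilon\in(0,1]$, $d\in\mathbb{N}$; strong polynomial tractability: this holds with $q=0$. *)

theory Defs
  imports "HOL-Probability.Essential_Supremum"
begin

section \<open>Functions on the unit cube\<close>

text \<open>The dimension \<open>d\<close> varies inside the statement, so points of \<open>[0,1]^d\<close> are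
  extensional functions on the index set \<open>{1..d}\<close>, and a real-valued function on \<open>[0,1]^d\<close>
  is an element of \<open>extensional (cube d)\<close>; this makes equality on the cube the same as HOL equality.\<close>

type_synonym cfun = "(nat \<Rightarrow> real) \<Rightarrow> real"

definition cube :: "nat \<Rightarrow> (nat \<Rightarrow> real) set" where
  "cube d = ({1..d} \<rightarrow>\<^sub>E {0..1})"

text \<open>Lebesgue measure (including its null sets) on \<open>[0,1]^d\<close>.\<close>

definition leb_cube :: "nat \<Rightarrow> (nat \<Rightarrow> real) measure" where
  "leb_cube d = completion (PiM {1..d} (\<lambda>_. restrict_space lborel {0..1}))"

text \<open>Elements of \<open>L\<^sub>\<infinity>([0,1]^d)\<close> are given by representatives; \<open>Linf_norm\<close> depends only on
  the class modulo equality almost everywhere. As \<open>real_of_ereal \<infinity> = 0\<close>, the real number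
  \<open>Linf_norm d f\<close> is meaningful for \<open>f \<in> Linf d\<close> only, and it is only used there.\<close>

definition Linf :: "nat \<Rightarrow> cfun set" where
  "Linf d = {f \<in> extensional (cube d). f \<in> borel_measurable (leb_cube d) \<and>
     esssup (leb_cube d) (\<lambda>x. ereal \<bar>f x\<bar>) < \<infinity>}"

definition Linf_norm :: "nat \<Rightarrow> cfun \<Rightarrow> real" where
  "Linf_norm d f = real_of_ereal (esssup (leb_cube d) (\<lambda>x. ereal \<bar>f x\<bar>))"

section \<open>Banach spaces of real-valued functions on a set\<close>

definition lincomb :: "'a set \<Rightarrow> real \<Rightarrow> ('a \<Rightarrow> real) \<Rightarrow> real \<Rightarrow> ('a \<Rightarrow> real) \<Rightarrow> 'a \<Rightarrow> real" where
  "lincomb X a f b g = (\<lambda>x\<in>X. a * f x + b * g x)"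

text \<open>The library locale \<open>Metric_space\<close> wants a nonnegative symmetric function on the whole type,
  hence the trivial value outside of the carrier \<open>V\<close>.\<close>

definition norm_dist :: "'a set \<Rightarrow> ('a \<Rightarrow> real) set \<Rightarrow> (('a \<Rightarrow> real) \<Rightarrow> real)
    \<Rightarrow> ('a \<Rightarrow> real) \<Rightarrow> ('a \<Rightarrow> real) \<Rightarrow> real" where
  "norm_dist X V N f g = (if f \<in> V \<and> g \<in> V then N (lincomb X 1 f (-1) g) else 0)"

definition normed_function_space :: "'a set \<Rightarrow> ('a \<Rightarrow> real) set \<Rightarrow> (('a \<Rightarrow> real) \<Rightarrow> real) \<Rightarrow> bool" where
  "normed_function_space X V N \<longleftrightarrow>
     V \<subseteq> extensional X \<and> (\<lambda>x\<in>X. 0) \<in> V \<and>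
     (\<forall>f\<in>V. \<forall>g\<in>V. \<forall>a b. lincomb X a f b g \<in> V) \<and>
     (\<forall>f\<in>V. 0 \<le> N f \<and> (N f = 0 \<longleftrightarrow> f = (\<lambda>x\<in>X. 0))) \<and>
     (\<forall>f\<in>V. \<forall>a. N (\<lambda>x\<in>X. a * f x) = \<bar>a\<bar> * N f) \<and>
     (\<forall>f\<in>V. \<forall>g\<in>V. N (\<lambda>x\<in>X. f x + g x) \<le> N f + N g)"

definition banach_function_space :: "'a set \<Rightarrow> ('a \<Rightarrow> real) set \<Rightarrow> (('a \<Rightarrow> real) \<Rightarrow> real) \<Rightarrow> bool" where
  "banach_function_space X V N \<longleftrightarrow>
     normed_function_space X V N \<and> Metric_space.mcomplete V (norm_dist X V N)"

definition continuous_functional ::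
    "'a set \<Rightarrow> ('a \<Rightarrow> real) set \<Rightarrow> (('a \<Rightarrow> real) \<Rightarrow> real) \<Rightarrow> (('a \<Rightarrow> real) \<Rightarrow> real) \<Rightarrow> bool" where
  "continuous_functional X V N L \<longleftrightarrow>
     continuous_map (Metric_space.mtopology V (norm_dist X V N)) euclideanreal L"

definition linear_functional :: "'a set \<Rightarrow> ('a \<Rightarrow> real) set \<Rightarrow> (('a \<Rightarrow> real) \<Rightarrow> real) \<Rightarrow> bool" where
  "linear_functional X V L \<longleftrightarrow>
     (\<forall>f\<in>V. \<forall>g\<in>V. \<forall>a b. L (lincomb X a f b g) = a * L f + b * L g)"

definition continuously_embedded ::
    "'b set \<Rightarrow> ('b \<Rightarrow> real) \<Rightarrow> 'b set \<Rightarrow> ('b \<Rightarrow> real) \<Rightarrow> bool" where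
  "continuously_embedded P M V N \<longleftrightarrow> P \<subseteq> V \<and> (\<exists>K. \<forall>f\<in>P. N f \<le> K * M f)"

text \<open>Operator norm of the identity from \<open>(P, M)\<close> to a space normed by \<open>N\<close>.\<close>

definition embedding_norm :: "'b set \<Rightarrow> ('b \<Rightarrow> real) \<Rightarrow> ('b \<Rightarrow> real) \<Rightarrow> real" where
  "embedding_norm P M N = (SUP f\<in>{f \<in> P. M f \<le> 1}. N f)"

section \<open>Product weights and the space of polynomials\<close>

definition multi_idx :: "nat \<Rightarrow> (nat \<Rightarrow> nat) set" where
  "multi_idx d = ({1..d} \<rightarrow>\<^sub>E {0, 1})"

definition prod_weight :: "(nat \<Rightarrow> nat \<Rightarrow> real) \<Rightarrow> nat \<Rightarrow> (nat \<Rightarrow> nat) \<Rightarrow> real" where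
  "prod_weight \<gamma> d \<alpha> = (\<Prod>j=1..d. \<gamma> d j ^ \<alpha> j)"

text \<open>The span of the monomials \<open>x \<mapsto> x^i\<close>, \<open>i \<in> {0,1}^d\<close>.\<close>

definition poly_space :: "nat \<Rightarrow> cfun set" where
  "poly_space d =
     {(\<lambda>x\<in>cube d. \<Sum>i\<in>multi_idx d. c i * (\<Prod>j=1..d. x j ^ i j)) | c :: (nat \<Rightarrow> nat) \<Rightarrow> real. True}"

text \<open>Partial derivatives on the closed cube, one-sided on its boundary.\<close>

definition partial_deriv :: "nat \<Rightarrow> nat \<Rightarrow> cfun \<Rightarrow> cfun" where
  "partial_deriv d j f =
     (\<lambda>x\<in>cube d. vector_derivative (\<lambda>t. f (x(j := t))) (at (x j) within {0..1}))"

definition mixed_deriv :: "nat \<Rightarrow> (nat \<Rightarrow> nat) \<Rightarrow> cfun \<Rightarrow> cfun" where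
  "mixed_deriv d \<alpha> f = foldr (\<lambda>j. partial_deriv d j ^^ \<alpha> j) [1..<Suc d] f"

definition poly_norm :: "(nat \<Rightarrow> nat \<Rightarrow> real) \<Rightarrow> nat \<Rightarrow> cfun \<Rightarrow> real" where
  "poly_norm \<gamma> d f =
     Max ((\<lambda>\<alpha>. 1 / prod_weight \<gamma> d \<alpha> * Linf_norm d (mixed_deriv d \<alpha> f)) ` multi_idx d)"

section \<open>Sum exponents\<close>

definition sum_exp_p :: "(nat \<Rightarrow> nat \<Rightarrow> real) \<Rightarrow> ereal" where
  "sum_exp_p \<gamma> = Inf {ereal \<kappa> | \<kappa>. 0 \<le> \<kappa> \<and>
     limsup (\<lambda>d. ereal (\<Sum>j=1..d. \<gamma> d j powr \<kappa>)) < \<infinity>}"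

definition sum_exp_q :: "(nat \<Rightarrow> nat \<Rightarrow> real) \<Rightarrow> ereal" where
  "sum_exp_q \<gamma> = Inf {ereal \<kappa> | \<kappa>. 0 \<le> \<kappa> \<and>
     limsup (\<lambda>d. ereal (\<Sum>j=1..d. \<gamma> d j powr \<kappa> / ln (real d + 1))) < \<infinity>}"

section \<open>Algorithms, minimal errors and information complexity\<close>

text \<open>Vectors of information in \<open>\<real>^n\<close> are lists of length \<open>n\<close>.\<close>

definition algs_cont :: "nat \<Rightarrow> cfun set \<Rightarrow> (cfun \<Rightarrow> real) \<Rightarrow> nat \<Rightarrow> (cfun \<Rightarrow> cfun) set" where
  "algs_cont d V N n = {(\<lambda>f. \<phi> (map (\<lambda>j. L j f) [1..<Suc n])) | \<phi> L.
     (\<forall>y. length y = n \<longrightarrow> \<phi> y \<in> Linf d) \<and>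
     (\<forall>j\<in>{1..n}. continuous_functional (cube d) V N (L j))}"

text \<open>\<open>L ys f\<close> stands for \<open>L\<^sub>j(f; y\<^sub>1, \<dots>, y\<^sub>j\<^sub>-\<^sub>1)\<close> with \<open>ys = [y\<^sub>1, \<dots>, y\<^sub>j\<^sub>-\<^sub>1]\<close>; the index \<open>j\<close>
  is determined by the length of \<open>ys\<close>.\<close>

primrec adapt_info :: "(real list \<Rightarrow> cfun \<Rightarrow> real) \<Rightarrow> nat \<Rightarrow> cfun \<Rightarrow> real list" where
  "adapt_info L 0 f = []"
| "adapt_info L (Suc n) f = adapt_info L n f @ [L (adapt_info L n f) f]"

definition algs_adapt :: "nat \<Rightarrow> cfun set \<Rightarrow> (cfun \<Rightarrow> real) \<Rightarrow> nat \<Rightarrow> (cfun \<Rightarrow> cfun) set" where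
  "algs_adapt d V N n = {(\<lambda>f. \<phi> (adapt_info L n f)) | \<phi> L.
     (\<forall>y. length y = n \<longrightarrow> \<phi> y \<in> Linf d) \<and>
     (\<forall>ys. length ys < n \<longrightarrow>
        linear_functional (cube d) V (L ys) \<and> continuous_functional (cube d) V N (L ys))}"

definition minimal_error :: "nat \<Rightarrow> cfun set \<Rightarrow> (cfun \<Rightarrow> real) \<Rightarrow> nat \<Rightarrow> ereal" where
  "minimal_error d V N n =
     (INF A \<in> algs_cont d V N n \<union> algs_adapt d V N n.
        SUP f \<in> {f \<in> V. N f \<le> 1}. ereal (Linf_norm d (\<lambda>x\<in>cube d. f x - A f x)))"

text \<open>The infimum of a set of extended naturals is its minimum, and \<open>\<infinity>\<close> for the empty set.\<close>

definition n_wor :: "real \<Rightarrow> nat \<Rightarrow> cfun set \<Rightarrow> (cfun \<Rightarrow> real) \<Rightarrow> enat" where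
  "n_wor \<epsilon> d V N = Inf {enat n | n. minimal_error d V N n \<le> ereal \<epsilon>}"

definition tractable_with_exponent ::
    "(nat \<Rightarrow> cfun set) \<Rightarrow> (nat \<Rightarrow> cfun \<Rightarrow> real) \<Rightarrow> real \<Rightarrow> bool" where
  "tractable_with_exponent F nrm q \<longleftrightarrow>
     (\<exists>C p. C > 0 \<and> p > 0 \<and>
        (\<forall>\<epsilon> d. 0 < \<epsilon> \<and> \<epsilon> \<le> 1 \<and> 1 \<le> d \<longrightarrow>
           ereal_of_enat (n_wor \<epsilon> d (F d) (nrm d)) \<le> ereal (C * \<epsilon> powr (- p) * real d powr q)))"

definition polynomially_tractable :: "(nat \<Rightarrow> cfun set) \<Rightarrow> (nat \<Rightarrow> cfun \<Rightarrow> real) \<Rightarrow> bool" where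
  "polynomially_tractable F nrm \<longleftrightarrow> (\<exists>q\<ge>0. tractable_with_exponent F nrm q)"

definition strongly_polynomially_tractable ::
    "(nat \<Rightarrow> cfun set) \<Rightarrow> (nat \<Rightarrow> cfun \<Rightarrow> real) \<Rightarrow> bool" where
  "strongly_polynomially_tractable F nrm \<longleftrightarrow> tractable_with_exponent F nrm 0"

end

theory Submission
  imports Defs
begin

text \<open>
  Split the coordinates greedily into \<open>s\<close> blocks of weight sum at least 2, each of weight sum at most
  \<open>2 + C\<^sub>\<gamma>\<close>, up to a remainder of weight sum below 2; then \<open>s > (\<Sum>j. \<gamma> d j) / (2 + C\<^sub>\<gamma>) - 1\<close>.
  Multilinear interpolation of \<open>2 ^ s\<close> vertex values, composed with the weighted block means, embeds
  \<open>\<real>^(2 ^ s)\<close> with the maximum norm into the polynomials. The embedding is isometric for the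
  sup norm, and it does not increase the norm of the polynomial space, because a derivative in
  direction \<open>j\<close> contributes at most the factor \<open>2 * \<gamma> d j / 2\<close>.

  It remains to see that \<open>n < m\<close> continuous functionals cannot distinguish all points of the cube
  \<open>[-1,1]^m\<close>: some two points on opposite faces have the same information, which forces an error of
  at least half their distance. Otherwise the images of opposite faces in \<open>\<real>^n\<close> have positive distance,
  and the differences of the distances to them form a Lipschitz map \<open>\<real>^n \<rightarrow> \<real>^m\<close> whose composition with
  the information map has, by the Poincare-Miranda theorem, a nonempty open set in its image;
  counting grid points contradicts \<open>n < m\<close>. This replaces the Borsuk-Ulam theorem, and Kuhn's
  combinatorial lemma gives it in every dimension without a type of that dimension.
\<close>

section \<open>Points on opposite faces with equal information\<close>

text \<open>The metric on functions from \<open>nat\<close> weights the coordinates by powers of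
  \<open>1 / 2\<close> with total weight 2; hence the factor. It turns coordinatewise estimates into
  distances.\<close>

lemma dist_fun_le_coordinates:
  fixes x y :: "nat \<Rightarrow> 'a::metric_space"
  assumes "\<And>i. dist (x i) (y i) \<le> e"
  shows "dist x y \<le> 2 * e"
proof (rule field_le_epsilon)
  fix \<eta> :: real assume "0 < \<eta>"
  then obtain N where N: "(1/2::real)^N < \<eta>"
    using real_arch_pow_inv[of \<eta> "1/2"] by auto
  let ?D = "{dist (x (from_nat n)) (y (from_nat n)) |n. n \<le> N}"
  have "?D = (\<lambda>n. dist (x (from_nat n)) (y (from_nat n))) ` {..N}" by auto
  then have "finite ?D" "?D \<noteq> {}" by auto
  then have "Max ?D \<le> e" using assms by (subst Max_le_iff) auto
  then show "dist x y \<le> 2 * e + \<eta>"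
    using dist_fun_le_dist_first_terms[of x y N] N by linarith
qed

text \<open>The cube \<open>[-1,1]^m\<close> inside the space of sequences. Fixing the further
  coordinates at 0 lets \<open>m\<close> be a variable and keeps the set compact in the product
  topology.\<close>

definition symm_box :: "nat \<Rightarrow> (nat \<Rightarrow> real) set" where
  "symm_box m = {x. (\<forall>i<m. \<bar>x i\<bar> \<le> 1) \<and> (\<forall>i\<ge>m. x i = 0)}"

lemma compact_symm_box: "compact (symm_box m)"
proof -
  have eq: "symm_box m = PiE UNIV (\<lambda>i. if i < m then {-1..1} else {0})"
    by (fastforce simp: symm_box_def PiE_UNIV_domain abs_le_iff split: if_splits)
  have "compactin (product_topology (\<lambda>i. euclidean) UNIV)
      (PiE UNIV (\<lambda>i::nat. if i < m then {-1..1} else {0::real}))"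
    by (subst compactin_PiE) auto
  then show ?thesis
    by (simp add: eq euclidean_product_topology)
qed

lemma uniform_modulus_finite_family:
  fixes f :: "nat \<Rightarrow> 'a::metric_space \<Rightarrow> 'b::metric_space"
  assumes "\<And>i. i < m \<Longrightarrow> uniformly_continuous_on K (f i)" and "0 < e"
  shows "\<exists>\<delta>>0. \<forall>i<m. \<forall>x\<in>K. \<forall>y\<in>K. dist x y < \<delta> \<longrightarrow> dist (f i x) (f i y) < e"
  using assms(1)
proof (induction m)
  case 0
  show ?case by (intro exI[of _ 1]) auto
next
  case (Suc m)
  from Suc obtain \<delta>1 where 1: "\<delta>1 > 0" "\<forall>i<m. \<forall>x\<in>K. \<forall>y\<in>K. dist x y < \<delta>1 \<longrightarrow> dist (f i x) (f i y) < e"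
    by (meson less_SucI)
  from Suc.prems[of m] obtain \<delta>2 where 2: "\<delta>2 > 0" "\<forall>x\<in>K. \<forall>y\<in>K. dist y x < \<delta>2 \<longrightarrow> dist (f m y) (f m x) < e"
    using \<open>0 < e\<close> unfolding uniformly_continuous_on_def by (metis lessI)
  show ?case
    using 1 2 by (intro exI[of _ "min \<delta>1 \<delta>2"]) (auto simp: less_Suc_eq)
qed

text \<open>An approximate form of the Poincare-Miranda theorem. Kuhn's lemma, applied to the signs
  of the components on a fine grid, finds a cell in which every component is at most 0 at one corner
  and at least 0 at another; uniform continuity then makes all components small there.\<close>

lemma approximate_zero_in_box:
  fixes H :: "(nat \<Rightarrow> real) \<Rightarrow> nat \<Rightarrow> real"
  assumes cont: "\<And>i. i < m \<Longrightarrow> continuous_on (symm_box m) (\<lambda>x. H x i)"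
    and neg: "\<And>x i. x \<in> symm_box m \<Longrightarrow> i < m \<Longrightarrow> x i = -1 \<Longrightarrow> H x i \<le> 0"
    and pos: "\<And>x i. x \<in> symm_box m \<Longrightarrow> i < m \<Longrightarrow> x i = 1 \<Longrightarrow> 0 \<le> H x i"
    and "0 < e"
  shows "\<exists>x\<in>symm_box m. \<forall>i<m. \<bar>H x i\<bar> \<le> e"
proof -
  obtain \<delta> where \<delta>: "\<delta> > 0"
    "\<forall>i<m. \<forall>x\<in>symm_box m. \<forall>y\<in>symm_box m. dist x y < \<delta> \<longrightarrow> dist (H x i) (H y i) < e"
    using uniform_modulus_finite_family[of m "symm_box m" "\<lambda>i x. H x i" e] \<open>0 < e\<close>
      compact_uniformly_continuous[OF cont compact_symm_box] by blast
  \<comment> \<open>Corners of one grid cell differ by at most \<open>2 / p\<close> in each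
    coordinate, hence by at most \<open>4 / p < \<delta>\<close> in the product metric.\<close>
  obtain p :: nat where p: "4 / \<delta> < real p" using reals_Archimedean2 by blast
  have p0: "0 < p" using p \<open>\<delta> > 0\<close> by (metis divide_pos_pos gr0I less_le_not_le less_trans of_nat_0 zero_less_numeral)
  define pt where "pt a = (\<lambda>i. if i < m then -1 + 2 * real (a i) / real p else 0)" for a :: "nat \<Rightarrow> nat"
  have pt: "pt a \<in> symm_box m" if "\<forall>i<m. a i \<le> p" for a
    using that p0 by (auto simp: symm_box_def pt_def abs_le_iff divide_simps)
  \<comment> \<open>Kuhn's lemma prescribes the label 0 on the lower faces and 1 on the upper ones;
    \<open>neg\<close> and \<open>pos\<close> make this agree with the sign of
    \<open>H\<close>.\<close>
  define label where "label a i =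
    (if a i = 0 then 0 else if a i = p then 1 else if H (pt a) i < 0 then 0 else (1::nat))" for a i
  have lab0: "H (pt a) i \<le> 0" if "\<forall>i<m. a i \<le> p" "i < m" "label a i = 0" for a i
  proof (cases "a i = 0")
    case True
    then show ?thesis using neg[OF pt[OF that(1)] that(2)] that(2) by (simp add: pt_def)
  qed (use that in \<open>auto simp: label_def split: if_splits\<close>)
  have lab1: "0 \<le> H (pt a) i" if "\<forall>i<m. a i \<le> p" "i < m" "label a i = 1" for a i
  proof (cases "a i = p")
    case True
    then show ?thesis using pos[OF pt[OF that(1)] that(2)] that(2) p0 by (simp add: pt_def)
  qed (use that in \<open>auto simp: label_def split: if_splits\<close>)
  obtain q where q: "\<forall>i<m. q i < p"
    and rs: "\<forall>i<m. \<exists>r s. (\<forall>j<m. q j \<le> r j \<and> r j \<le> q j + 1) \<and>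
        (\<forall>j<m. q j \<le> s j \<and> s j \<le> q j + 1) \<and> label r i \<noteq> label s i"
    by (rule kuhn_lemma[of p m label]) (use p0 in \<open>auto simp: label_def\<close>)
  have qp: "\<forall>i<m. q i \<le> p" using q by (simp add: less_imp_le)
  have near: "\<bar>H (pt r) i - H (pt q) i\<bar> < e \<and> (\<forall>j<m. r j \<le> p)"
    if "\<forall>j<m. q j \<le> r j \<and> r j \<le> q j + 1" "i < m" for r i
  proof
    show rp: "\<forall>j<m. r j \<le> p" using that q by (metis Suc_eq_plus1 Suc_leI le_trans)
    have "dist (pt r j) (pt q j) \<le> 2 / p" for j
    proof (cases "j < m")
      case True
      then have "real (r j) - real (q j) \<le> 1" "0 \<le> real (r j) - real (q j)" using that(1) by force+
      then show ?thesis using p0 True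
        by (auto simp: pt_def dist_real_def abs_le_iff divide_simps)
    qed (simp add: pt_def)
    then have "dist (pt r) (pt q) \<le> 2 * (2 / p)" by (rule dist_fun_le_coordinates)
    also have "\<dots> < \<delta>" using p p0 \<delta>(1) by (simp add: field_simps)
    finally show "\<bar>H (pt r) i - H (pt q) i\<bar> < e"
      using \<delta>(2) pt[OF qp] pt[OF rp] \<open>i < m\<close> by (auto simp: dist_real_def)
  qed
  have "\<bar>H (pt q) i\<bar> \<le> e" if i: "i < m" for i
  proof -
    obtain r s where r: "\<forall>j<m. q j \<le> r j \<and> r j \<le> q j + 1"
      and s: "\<forall>j<m. q j \<le> s j \<and> s j \<le> q j + 1" and l: "label r i \<noteq> label s i"
      using rs i by blast
    note nr = near[OF r i] and ns = near[OF s i]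
    \<comment> \<open>Different labels give values of opposite sign at \<open>r\<close> and
      \<open>s\<close>. Both lie within \<open>e\<close> of the value at \<open>q\<close>, which
      therefore lies between \<open>-e\<close> and \<open>e\<close>.\<close>
    have "label r i = 0 \<and> label s i = 1 \<or> label r i = 1 \<and> label s i = 0"
      using l by (auto simp: label_def split: if_splits)
    then show ?thesis
      using lab0[of r i] lab1[of s i] lab0[of s i] lab1[of r i] nr ns i by argo
  qed
  then show ?thesis using pt[OF qp] by blast
qed

lemma separated_compact_sets:
  fixes S T :: "'a::metric_space set"
  assumes "compact S" "compact T" "S \<inter> T = {}"
  shows "\<exists>\<delta>>0. \<forall>x\<in>S. \<forall>y\<in>T. \<delta> \<le> dist x y"
proof (cases "S \<times> T = {}")
  case True
  then show ?thesis by (intro exI[of _ 1]) auto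
next
  case False
  have "continuous_on (S \<times> T) (\<lambda>p. dist (fst p) (snd p))"
    by (intro continuous_intros)
  then obtain p where p: "p \<in> S \<times> T" "\<forall>q\<in>S \<times> T. dist (fst p) (snd p) \<le> dist (fst q) (snd q)"
    using continuous_attains_inf[OF compact_Times[OF assms(1,2)] False] by blast
  then have "fst p \<noteq> snd p" using assms(3) by auto
  then show ?thesis using p by (intro exI[of _ "dist (fst p) (snd p)"]) auto
qed

text \<open>If the claim failed, a map \<open>H\<close> that is Lipschitz in the information alone
  would come arbitrarily close to every point of \<open>[0,\<delta>]^m\<close>. Approximating
  \<open>M ^ m\<close> grid points takes \<open>M ^ m\<close> distinct cells of information, while
  at most \<open>(c * M) ^ n\<close> cells are available, too few for large
  \<open>M\<close>.\<close>

lemma opposite_faces_meet_fiber: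
  fixes N :: "(nat \<Rightarrow> real) \<Rightarrow> nat \<Rightarrow> real"
  assumes cont: "\<And>j. j < n \<Longrightarrow> continuous_on (symm_box m) (\<lambda>x. N x j)" and "n < m"
  shows "\<exists>x\<in>symm_box m. \<exists>y\<in>symm_box m. \<exists>i<m. x i = -1 \<and> y i = 1 \<and> (\<forall>j<n. N x j = N y j)"
proof (rule ccontr)
  assume contr: "\<not> ?thesis"
  \<comment> \<open>Padding with zeros puts the information vectors into one metric space, whatever
    \<open>n\<close> is.\<close>
  define g where "g x = (\<lambda>j. if j < n then N x j else 0)" for x
  have cont_g: "continuous_on (symm_box m) g"
    unfolding g_def
  proof (rule continuous_on_coordinatewise_then_product)
    show "continuous_on (symm_box m) (\<lambda>x. if j < n then N x j else 0)" for j
      by (cases "j < n") (simp_all add: cont)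
  qed
  define face where "face i s = symm_box m \<inter> {x. x i = s}" for i :: nat and s :: real
  have "closed {x :: nat \<Rightarrow> real. x i = s}" for i s
    by (intro closed_Collect_eq continuous_intros) simp
  then have compact_face: "compact (g ` face i s)" for i s
    unfolding face_def
    by (intro compact_continuous_image compact_Int_closed compact_symm_box
        continuous_on_subset[OF cont_g]) auto
  \<comment> \<open>The function \<open>infdist\<close> is 0 for the empty set by convention, so its
    lower bounds below rest on nonempty faces.\<close>
  have "(\<lambda>j. if j = i then s else 0) \<in> face i s" if "i < m" "\<bar>s\<bar> \<le> 1" for i s
    using that by (auto simp: face_def symm_box_def)
  then have face_ne: "g ` face i s \<noteq> {}" if "i < m" "\<bar>s\<bar> \<le> 1" for i s
    using that by blast
  have disj: "g ` face i (-1) \<inter> g ` face i 1 = {}" if "i < m" for i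
  proof (rule ccontr)
    assume "g ` face i (-1) \<inter> g ` face i 1 \<noteq> {}"
    then obtain x y where "x \<in> face i (-1)" "y \<in> face i 1" "g x = g y" by auto
    moreover from \<open>g x = g y\<close> have "\<forall>j<n. N x j = N y j"
      unfolding g_def by meson
    ultimately show False using contr that unfolding face_def by blast
  qed
  have "\<forall>i\<in>{..<m}. \<exists>\<delta>>0. \<forall>u\<in>g ` face i (-1). \<forall>v\<in>g ` face i 1. \<delta> \<le> dist u v"
    using separated_compact_sets[OF compact_face compact_face disj] by blast
  then obtain \<Delta> where \<Delta>: "\<forall>i\<in>{..<m}. 0 < \<Delta> i \<and>
      (\<forall>u\<in>g ` face i (-1). \<forall>v\<in>g ` face i 1. \<Delta> i \<le> dist u v)"
    by (metis (full_types))
  define \<delta> where "\<delta> = Min (\<Delta> ` {..<m})"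
  have "m > 0" using \<open>n < m\<close> by simp
  have "\<delta> \<in> \<Delta> ` {..<m}" unfolding \<delta>_def using \<open>m > 0\<close> by (intro Min_in) auto
  then have \<delta>0: "0 < \<delta>" using \<Delta> by auto
  have "\<delta> \<le> \<Delta> i" if "i < m" for i unfolding \<delta>_def using that by (intro Min_le) auto
  then have sep: "\<delta> \<le> dist u v" if "i < m" "u \<in> g ` face i (-1)" "v \<in> g ` face i 1" for i u v
    using \<Delta> that by (meson lessThan_iff order_trans)
  \<comment> \<open>The signed distance between the images of the two opposite faces: at most
    \<open>-\<delta>\<close> on the lower face, at least \<open>\<delta>\<close> on the upper one,
    and a function of \<open>g x\<close> only.\<close>
  define H where "H x i = infdist (g x) (g ` face i (-1)) - infdist (g x) (g ` face i 1)" for x i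
  have contH: "continuous_on (symm_box m) (\<lambda>x. H x i)" for i
    unfolding H_def by (intro continuous_intros cont_g)
  have H_neg: "H x i \<le> - \<delta>" if "x \<in> symm_box m" "i < m" "x i = -1" for x i
  proof -
    have gx: "g x \<in> g ` face i (-1)" using that by (auto simp: face_def)
    have "\<delta> \<le> infdist (g x) (g ` face i 1)"
      using face_ne[OF \<open>i < m\<close>, of 1] sep[OF \<open>i < m\<close> gx] by (simp add: infdist_notempty cINF_greatest)
    then show ?thesis using gx by (simp add: H_def)
  qed
  have H_pos: "\<delta> \<le> H x i" if "x \<in> symm_box m" "i < m" "x i = 1" for x i
  proof -
    have gx: "g x \<in> g ` face i 1" using that by (auto simp: face_def)
    have "\<delta> \<le> infdist (g x) (g ` face i (-1))"
      using face_ne[OF \<open>i < m\<close>, of "-1"] sep[OF \<open>i < m\<close> _ gx]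
      by (simp add: infdist_notempty cINF_greatest dist_commute)
    then show ?thesis using gx by (simp add: H_def)
  qed
  \<comment> \<open>One factor 2 comes from the product metric, the other from the two distances in
    \<open>H\<close>.\<close>
  have H_lip: "\<bar>H x i - H y i\<bar> \<le> 4 * e" if "\<And>j. j < n \<Longrightarrow> \<bar>N x j - N y j\<bar> \<le> e" "0 \<le> e" for x y i e
  proof -
    have "dist (g x) (g y) \<le> 2 * e"
      using that by (intro dist_fun_le_coordinates) (simp add: g_def dist_real_def)
    then show ?thesis
      using infdist_triangle_abs[of "g x" "g ` face i (-1)" "g y"]
        infdist_triangle_abs[of "g x" "g ` face i 1" "g y"]
      unfolding H_def by linarith
  qed
  obtain R where R: "\<forall>x\<in>symm_box m. \<forall>j<n. \<bar>N x j\<bar> \<le> R"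
  proof -
    have "\<exists>R. \<forall>x\<in>symm_box m. \<bar>N x j\<bar> \<le> R" if "j < n" for j
      using compact_imp_bounded[OF compact_continuous_image[OF cont[OF that] compact_symm_box]]
      unfolding bounded_iff by auto
    then obtain r where r: "\<forall>j<n. \<forall>x\<in>symm_box m. \<bar>N x j\<bar> \<le> r j" by metis
    have "r j \<le> Max (r ` {..<n})" if "j < n" for j using that by simp
    then show thesis using r that[of "Max (r ` {..<n})"] by (meson order_trans)
  qed
  have "\<bar>R\<bar> \<ge> R" by simp
  \<comment> \<open>The constant \<open>c\<close> is independent of \<open>M\<close> and such that
    \<open>c * M\<close> cells per direction suffice. Then \<open>M\<close> is taken one larger than
    \<open>c ^ n\<close>, so that \<open>M ^ Suc n \<le> c ^ n * M ^ n\<close> becomes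
    impossible.\<close>
  obtain c :: nat where c: "32 * (\<bar>R\<bar> / \<delta>) + 5 \<le> real c" using real_arch_simple by blast
  define M where "M = Suc (c ^ n)"
  have M0: "0 < M" by (simp add: M_def)
  define t where "t a i = \<delta> * real (a i) / real M" for a :: "nat \<Rightarrow> nat" and i :: nat
  \<comment> \<open>Subtracting a target in \<open>[0,\<delta>]\<close> preserves the signs on the
    faces. So \<open>H\<close> attains every grid point up to a quarter of the grid spacing
    \<open>\<delta> / M\<close>.\<close>
  have "\<exists>x\<in>symm_box m. \<forall>i<m. \<bar>H x i - t a i\<bar> \<le> \<delta> / (4 * M)" if "a \<in> {..<m} \<rightarrow>\<^sub>E {..<M}" for a
  proof (rule approximate_zero_in_box)
    have t: "0 \<le> t a i" "t a i \<le> \<delta>" if "i < m" for i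
    proof -
      have "real (a i) \<le> real M" using \<open>a \<in> _\<close> that by (auto intro: less_imp_le)
      then show "0 \<le> t a i" "t a i \<le> \<delta>" using \<delta>0 M0 by (auto simp: t_def divide_le_eq)
    qed
    show "H x i - t a i \<le> 0" if "x \<in> symm_box m" "i < m" "x i = -1" for x i
      using H_neg[OF that] t[OF \<open>i < m\<close>] \<delta>0 by linarith
    show "0 \<le> H x i - t a i" if "x \<in> symm_box m" "i < m" "x i = 1" for x i
      using H_pos[OF that] t[OF \<open>i < m\<close>] by linarith
    show "0 < \<delta> / (4 * M)" using \<delta>0 M0 by simp
  qed (intro continuous_intros contH)
  then obtain X where X: "\<And>a. a \<in> {..<m} \<rightarrow>\<^sub>E {..<M} \<Longrightarrow> X a \<in> symm_box m"
      "\<And>a i. a \<in> {..<m} \<rightarrow>\<^sub>E {..<M} \<Longrightarrow> i < m \<Longrightarrow> \<bar>H (X a) i - t a i\<bar> \<le> \<delta> / (4 * M)"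
    by metis
  \<comment> \<open>With this cell width, points sharing a cell have values of \<open>H\<close> at
    most \<open>\<delta> / (4 * M)\<close> apart. Adding the two tolerances gives three quarters of
    the grid spacing, so distinct targets lie in distinct cells.\<close>
  define w where "w = \<delta> / (16 * M)"
  have w0: "0 < w" using \<delta>0 M0 by (simp add: w_def)
  define B where "B = \<lceil>\<bar>R\<bar> / w\<rceil>"
  define cell where "cell a = (\<lambda>j\<in>{..<n}. \<lfloor>N (X a) j / w\<rfloor>)" for a
  have cell_in: "cell a \<in> {..<n} \<rightarrow>\<^sub>E {-B-1..B}" if "a \<in> {..<m} \<rightarrow>\<^sub>E {..<M}" for a
  proof -
    have "\<lfloor>N (X a) j / w\<rfloor> \<in> {-B-1..B}" if "j < n" for j
    proof -
      have "\<bar>N (X a) j\<bar> \<le> \<bar>R\<bar>" using R X(1)[OF \<open>a \<in> _\<close>] that by (meson \<open>\<bar>R\<bar> \<ge> R\<close> order_trans)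
      then have "\<bar>N (X a) j / w\<bar> \<le> \<bar>R\<bar> / w" using w0 by (simp add: divide_right_mono)
      then show ?thesis unfolding B_def atLeastAtMost_iff by linarith
    qed
    then show ?thesis by (auto simp: cell_def)
  qed
  have inj: "inj_on cell ({..<m} \<rightarrow>\<^sub>E {..<M})"
  proof (rule inj_onI, rule ccontr)
    fix a b assume a: "a \<in> {..<m} \<rightarrow>\<^sub>E {..<M}" and b: "b \<in> {..<m} \<rightarrow>\<^sub>E {..<M}"
      and eq: "cell a = cell b" and "a \<noteq> b"
    then obtain i where i: "i < m" "a i \<noteq> b i" by (metis PiE_ext lessThan_iff)
    have "\<bar>N (X a) j - N (X b) j\<bar> \<le> w" if "j < n" for j
    proof -
      have "\<lfloor>N (X a) j / w\<rfloor> = \<lfloor>N (X b) j / w\<rfloor>"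
        using fun_cong[OF eq, of j] that by (simp add: cell_def)
      then have "\<bar>N (X a) j / w - N (X b) j / w\<bar> \<le> 1" by linarith
      then show ?thesis using w0 by (simp add: diff_divide_distrib[symmetric] divide_le_eq)
    qed
    then have "\<bar>H (X a) i - H (X b) i\<bar> \<le> 4 * w" using w0 by (intro H_lip) auto
    moreover have "4 * w = \<delta> / (4 * M)" by (simp add: w_def)
    ultimately have "\<bar>t a i - t b i\<bar> \<le> 3 * (\<delta> / (4 * M))"
      using X(2)[OF a i(1)] X(2)[OF b i(1)] by linarith
    moreover have "1 * (\<delta> / M) \<le> \<bar>real (a i) - real (b i)\<bar> * (\<delta> / M)"
      using i(2) \<delta>0 by (intro mult_right_mono) auto
    moreover have "\<bar>t a i - t b i\<bar> = \<bar>real (a i) - real (b i)\<bar> * (\<delta> / M)"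
      using \<delta>0 by (simp add: t_def diff_divide_distrib[symmetric] right_diff_distrib[symmetric] abs_mult)
    ultimately have "\<delta> / M \<le> 3 * (\<delta> / (4 * M))" by simp
    then show False using \<delta>0 M0 by (simp add: field_simps)
  qed
  have "M ^ m = card ({..<m} \<rightarrow>\<^sub>E {..<M})" by (simp add: card_PiE)
  also have "\<dots> \<le> card ({..<n} \<rightarrow>\<^sub>E {-B-1..B})"
    using inj cell_in by (intro card_inj_on_le[of cell]) (auto intro: finite_PiE)
  also have "\<dots> = nat (2 * B + 2) ^ n" by (simp add: card_PiE algebra_simps)
  also have "\<dots> \<le> (c * M) ^ n"
  proof (rule power_mono)
    have "real_of_int B \<le> \<bar>R\<bar> / w + 1" by (simp add: B_def)
    also have "\<bar>R\<bar> / w = 16 * (\<bar>R\<bar> / \<delta>) * M" by (simp add: w_def field_simps)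
    finally have "2 * real_of_int B + 2 \<le> (32 * (\<bar>R\<bar> / \<delta>)) * M + 4" by simp
    also have "\<dots> \<le> (32 * (\<bar>R\<bar> / \<delta>) + 5) * M" using M0 by (simp add: algebra_simps)
    also have "\<dots> \<le> real c * real M" using c by (intro mult_right_mono) auto
    finally have "real_of_int (2 * B + 2) \<le> real_of_int (int (c * M))" by simp
    then show "nat (2 * B + 2) \<le> c * M" by linarith
  qed simp
  finally have "M ^ m \<le> c ^ n * M ^ n" by (simp add: power_mult_distrib)
  moreover have "M ^ Suc n \<le> M ^ m" using M0 \<open>n < m\<close> by (intro power_increasing) auto
  ultimately have "M ^ Suc n \<le> c ^ n * M ^ n" by (rule order_trans[rotated])
  then have "M \<le> c ^ n" using M0 by simp
  then show False by (simp add: M_def)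
qed

section \<open>Multilinear interpolation and blocks of coordinates\<close>

text \<open>The multilinear interpolant on \<open>[0,1]^s\<close> of prescribed vertex values; a
  vertex is coded by the set of its coordinates equal to 1.\<close>

primrec vertex_interp :: "nat \<Rightarrow> (nat set \<Rightarrow> real) \<Rightarrow> (nat \<Rightarrow> real) \<Rightarrow> real" where
  "vertex_interp 0 a v = a {}"
| "vertex_interp (Suc s) a v =
     (1 - v s) * vertex_interp s a v + v s * vertex_interp s (\<lambda>\<beta>. a (insert s \<beta>)) v"

lemma vertex_interp_cong:
  assumes "\<And>\<beta>. \<beta> \<subseteq> {..<s} \<Longrightarrow> a \<beta> = b \<beta>" "\<And>k. k < s \<Longrightarrow> v k = w k"
  shows "vertex_interp s a v = vertex_interp s b w"
  using assms
proof (induction s arbitrary: a b)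
  case (Suc s)
  have "vertex_interp s a v = vertex_interp s b w"
    using Suc.prems by (intro Suc.IH) (auto simp: lessThan_Suc)
  moreover have "vertex_interp s (\<lambda>\<beta>. a (insert s \<beta>)) v = vertex_interp s (\<lambda>\<beta>. b (insert s \<beta>)) w"
    by (intro Suc.IH Suc.prems) (auto simp: lessThan_Suc)
  ultimately show ?case using Suc.prems(2)[of s] by simp
qed simp

lemma vertex_interp_vertex:
  assumes "\<beta> \<subseteq> {..<s}" "\<And>k. k < s \<Longrightarrow> v k = (if k \<in> \<beta> then 1 else 0)"
  shows "vertex_interp s a v = a \<beta>"
  using assms
proof (induction s arbitrary: a \<beta>)
  case (Suc s)
  have eq: "vertex_interp s a' v = a' (\<beta> - {s})" for a'
    using Suc.prems by (intro Suc.IH) (auto simp: lessThan_Suc)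
  show ?case
  proof (cases "s \<in> \<beta>")
    case True
    then show ?thesis using Suc.prems(2)[of s] by (simp add: eq insert_absorb)
  next
    case False
    then show ?thesis using Suc.prems(2)[of s] by (simp add: eq)
  qed
qed simp

text \<open>On the cube the interpolant is a convex combination of the vertex values.\<close>

lemma abs_vertex_interp_le:
  assumes "\<And>\<beta>. \<bar>a \<beta>\<bar> \<le> B" "\<And>k. k < s \<Longrightarrow> 0 \<le> v k \<and> v k \<le> 1"
  shows "\<bar>vertex_interp s a v\<bar> \<le> B"
  using assms
proof (induction s arbitrary: a)
  case (Suc s)
  have vs: "0 \<le> v s" "v s \<le> 1" using Suc.prems(2)[of s] by auto
  have "\<bar>vertex_interp (Suc s) a v\<bar> \<le>
      (1 - v s) * \<bar>vertex_interp s a v\<bar> + v s * \<bar>vertex_interp s (\<lambda>\<beta>. a (insert s \<beta>)) v\<bar>"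
    using vs by (auto simp: abs_mult intro!: order_trans[OF abs_triangle_ineq])
  also have "\<dots> \<le> (1 - v s) * B + v s * B"
    using vs Suc.prems by (intro add_mono mult_left_mono Suc.IH) auto
  finally show ?case by (simp add: algebra_simps)
qed simp

lemma vertex_interp_linear:
  "vertex_interp s (\<lambda>\<beta>. c * a \<beta> + d * b \<beta>) v = c * vertex_interp s a v + d * vertex_interp s b v"
  by (induction s arbitrary: a b) (simp_all add: algebra_simps)

text \<open>The interpolant is affine in \<open>v k\<close>, so its slope is the difference of its
  values at 1 and 0. Writing this as an interpolant of differences allows derivatives to be
  iterated.\<close>

lemma vertex_interp_partial_derivative:
  assumes "k < s"
  shows "((\<lambda>t. vertex_interp s a (v(k := t))) has_real_derivative
           vertex_interp s (\<lambda>\<beta>. a (insert k \<beta>) - a (\<beta> - {k})) v) (at t)"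
  using assms
proof (induction s arbitrary: a)
  case (Suc s)
  show ?case
  proof (cases "k = s")
    case True
    let ?P = "vertex_interp s a v" and ?Q = "vertex_interp s (\<lambda>\<beta>. a (insert s \<beta>)) v"
    have upd: "vertex_interp s b (v(s := t)) = vertex_interp s b v" for b t
      by (rule vertex_interp_cong) auto
    have 1: "vertex_interp s (\<lambda>\<beta>. a (insert s \<beta>) - a (\<beta> - {s})) v = ?Q - ?P"
    proof -
      have "vertex_interp s (\<lambda>\<beta>. a (insert s \<beta>) - a (\<beta> - {s})) v
          = vertex_interp s (\<lambda>\<beta>. 1 * a (insert s \<beta>) + (-1) * a \<beta>) v"
      proof (rule vertex_interp_cong)
        fix \<beta> assume "\<beta> \<subseteq> {..<s}"
        then have "\<beta> - {s} = \<beta>" by auto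
        then show "a (insert s \<beta>) - a (\<beta> - {s}) = 1 * a (insert s \<beta>) + (-1) * a \<beta>" by simp
      qed simp
      then show ?thesis by (simp only: vertex_interp_linear)
    qed
    have 2: "vertex_interp s (\<lambda>\<beta>. a (insert s (insert s \<beta>)) - a (insert s \<beta> - {s})) v = ?Q - ?P"
      unfolding 1[symmetric] by (rule vertex_interp_cong) auto
    have "((\<lambda>t. (1 - t) * ?P + t * ?Q) has_real_derivative (?Q - ?P)) (at t)"
      by (auto intro!: derivative_eq_intros)
    moreover have "vertex_interp (Suc s) (\<lambda>\<beta>. a (insert s \<beta>) - a (\<beta> - {s})) v = ?Q - ?P"
      by (simp only: vertex_interp.simps 1 2) argo
    ultimately show ?thesis
      unfolding True by (simp only: vertex_interp.simps upd fun_upd_same)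
  next
    case False
    then have "k < s" using Suc.prems by simp
    have eq: "(\<lambda>\<beta>. a (insert k (insert s \<beta>)) - a (insert s \<beta> - {k})) =
        (\<lambda>\<beta>. a (insert s (insert k \<beta>)) - a (insert s (\<beta> - {k})))"
      using False by (auto simp: insert_commute insert_Diff_if)
    show ?thesis
      using False Suc.IH[OF \<open>k < s\<close>, of a] Suc.IH[OF \<open>k < s\<close>, of "\<lambda>\<beta>. a (insert s \<beta>)"]
      by (auto simp: eq intro!: derivative_eq_intros)
  qed
qed simp

section \<open>Polynomials of degree at most one in each variable, with monomials coded by sets of
  variables\<close>

definition multilinear_in :: "nat set \<Rightarrow> ((nat \<Rightarrow> real) \<Rightarrow> real) \<Rightarrow> bool" where
  "multilinear_in A f \<longleftrightarrow> (\<exists>c. \<forall>y. f y = (\<Sum>B\<in>Pow A. c B * (\<Prod>j\<in>B. y j)))"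

lemma multilinear_in_const: "multilinear_in {} (\<lambda>y. r)"
  unfolding multilinear_in_def by (rule exI[of _ "\<lambda>_. r"]) simp

lemma multilinear_in_mono:
  assumes "multilinear_in A f" "A \<subseteq> A'" "finite A'"
  shows "multilinear_in A' f"
proof -
  obtain c where c: "\<And>y. f y = (\<Sum>B\<in>Pow A. c B * (\<Prod>j\<in>B. y j))"
    using assms(1) unfolding multilinear_in_def by blast
  have "f y = (\<Sum>B\<in>Pow A'. (if B \<subseteq> A then c B else 0) * (\<Prod>j\<in>B. y j))" for y
    unfolding c using assms(2,3) by (intro sum.mono_neutral_cong_left) auto
  then show ?thesis unfolding multilinear_in_def
    by (intro exI[of _ "\<lambda>B. if B \<subseteq> A then c B else 0"]) blast
qed

lemma multilinear_in_add:
  assumes "multilinear_in A f" "multilinear_in A g"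
  shows "multilinear_in A (\<lambda>y. f y + g y)"
proof -
  obtain c e where "\<And>y. f y = (\<Sum>B\<in>Pow A. c B * (\<Prod>j\<in>B. y j))" "\<And>y. g y = (\<Sum>B\<in>Pow A. e B * (\<Prod>j\<in>B. y j))"
    using assms unfolding multilinear_in_def by blast
  then show ?thesis unfolding multilinear_in_def
    by (intro exI[of _ "\<lambda>B. c B + e B"]) (simp add: sum.distrib distrib_right)
qed

lemma multilinear_in_scale:
  assumes "multilinear_in A f"
  shows "multilinear_in A (\<lambda>y. r * f y)"
proof -
  obtain c where "\<And>y. f y = (\<Sum>B\<in>Pow A. c B * (\<Prod>j\<in>B. y j))"
    using assms unfolding multilinear_in_def by blast
  then show ?thesis unfolding multilinear_in_def
    by (intro exI[of _ "\<lambda>B. r * c B"]) (simp add: sum_distrib_left mult.assoc)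
qed

text \<open>Since \<open>j\<close> is a new variable, no square arises: the coefficient of
  \<open>B\<close> merely moves to \<open>insert j B\<close>.\<close>

lemma multilinear_in_times_coordinate:
  assumes "multilinear_in A f" "finite A" "j \<notin> A"
  shows "multilinear_in (insert j A) (\<lambda>y. y j * f y)"
proof -
  obtain c where c: "\<And>y. f y = (\<Sum>B\<in>Pow A. c B * (\<Prod>j\<in>B. y j))"
    using assms(1) unfolding multilinear_in_def by blast
  define e where "e B = (if j \<in> B then c (B - {j}) else 0)" for B
  have "y j * f y = (\<Sum>B\<in>Pow (insert j A). e B * (\<Prod>j\<in>B. y j))" for y
  proof -
    have inj: "inj_on (insert j) (Pow A)" using assms(3) by (force simp: inj_on_def)
    have "(\<Sum>B\<in>Pow (insert j A). e B * (\<Prod>j\<in>B. y j)) = (\<Sum>B\<in>insert j ` Pow A. e B * (\<Prod>j\<in>B. y j))"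
      using assms(2) by (intro sum.mono_neutral_right) (auto simp: Pow_insert e_def)
    also have "\<dots> = (\<Sum>B\<in>Pow A. e (insert j B) * (\<Prod>j\<in>insert j B. y j))"
      by (simp add: sum.reindex[OF inj])
    also have "\<dots> = (\<Sum>B\<in>Pow A. y j * (c B * (\<Prod>j\<in>B. y j)))"
    proof (rule sum.cong[OF refl])
      fix B assume "B \<in> Pow A"
      then have "j \<notin> B" "finite B" using assms finite_subset by auto
      then show "e (insert j B) * (\<Prod>j\<in>insert j B. y j) = y j * (c B * (\<Prod>j\<in>B. y j))"
        by (simp add: e_def)
    qed
    finally show ?thesis by (simp add: c sum_distrib_left)
  qed
  then show ?thesis unfolding multilinear_in_def by blast
qed

lemma multilinear_in_times_linear:
  assumes "multilinear_in A f" "finite A" "finite I" "I \<inter> A = {}"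
  shows "multilinear_in (A \<union> I) (\<lambda>y. (\<Sum>j\<in>I. w j * y j) * f y)"
  using assms(3,4)
proof (induction I rule: finite_induct)
  case empty
  show ?case using multilinear_in_scale[OF assms(1), of 0] by simp
next
  case (insert i I)
  have "multilinear_in (insert i A) (\<lambda>y. y i * (w i * f y))"
    using insert.prems multilinear_in_scale[OF assms(1)] assms(2)
    by (intro multilinear_in_times_coordinate) auto
  then have "multilinear_in (A \<union> insert i I) (\<lambda>y. y i * (w i * f y))"
    by (rule multilinear_in_mono) (use assms(2) insert in auto)
  moreover have "multilinear_in (A \<union> insert i I) (\<lambda>y. (\<Sum>j\<in>I. w j * y j) * f y)"
    by (rule multilinear_in_mono[OF insert.IH]) (use assms(2) insert in auto)
  ultimately have "multilinear_in (A \<union> insert i I)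
      (\<lambda>y. y i * (w i * f y) + (\<Sum>j\<in>I. w j * y j) * f y)"
    by (rule multilinear_in_add)
  then show ?case
    using insert.hyps by (simp add: algebra_simps)
qed

text \<open>In the recursion the linear form of block \<open>s\<close> multiplies a polynomial in
  the variables of the earlier blocks only. Disjointness of the blocks thus keeps the degree in
  every variable at most one.\<close>

lemma multilinear_in_vertex_interp:
  assumes fin: "\<And>k. finite (I k)" and disj: "\<And>k l. k \<noteq> l \<Longrightarrow> I k \<inter> I l = {}"
  shows "multilinear_in (\<Union>k<s. I k) (\<lambda>y. vertex_interp s a (\<lambda>k. \<Sum>j\<in>I k. w j * y j))"
proof (induction s arbitrary: a)
  case 0
  show ?case by (simp add: multilinear_in_const)
next
  case (Suc s)
  let ?A = "\<Union>k<s. I k"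
  define u where "u = (\<lambda>(y :: nat \<Rightarrow> real) k. \<Sum>j\<in>I k. w j * y j)"
  have IH: "multilinear_in ?A (\<lambda>y. vertex_interp s b (u y))" for b
    using Suc.IH[of b] by (simp add: u_def)
  have eq: "(\<Union>k<Suc s. I k) = ?A \<union> I s" by (simp add: lessThan_Suc Un_commute)
  have "I s \<inter> I k = {}" if "k < s" for k using disj[of s k] that by simp
  then have disj': "I s \<inter> ?A = {}" by blast
  have finA: "finite ?A" using fin by simp
  have 1: "multilinear_in (?A \<union> I s) (\<lambda>y. vertex_interp s a (u y))"
    by (rule multilinear_in_mono[OF IH]) (simp_all add: fin)
  have "multilinear_in ?A
      (\<lambda>y. vertex_interp s (\<lambda>\<beta>. a (insert s \<beta>)) (u y) + (-1) * vertex_interp s a (u y))"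
    by (rule multilinear_in_add[OF IH multilinear_in_scale[OF IH]])
  from multilinear_in_times_linear[OF this finA fin disj', of w]
  have 2: "multilinear_in (?A \<union> I s)
      (\<lambda>y. u y s * (vertex_interp s (\<lambda>\<beta>. a (insert s \<beta>)) (u y) + (-1) * vertex_interp s a (u y)))"
    by (simp add: u_def)
  have "vertex_interp (Suc s) a (u y) = vertex_interp s a (u y) +
      u y s * (vertex_interp s (\<lambda>\<beta>. a (insert s \<beta>)) (u y) + (-1) * vertex_interp s a (u y))" for y
    by (simp only: vertex_interp.simps) argo
  then have "multilinear_in (\<Union>k<Suc s. I k) (\<lambda>y. vertex_interp (Suc s) a (u y))"
    using multilinear_in_add[OF 1 2] by (simp only: eq)
  then show ?case unfolding u_def .
qed

lemma multilinear_in_poly_space: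
  assumes "multilinear_in {1..d} f"
  shows "(\<lambda>x\<in>cube d. f x) \<in> poly_space d"
proof -
  obtain c where c: "\<And>y. f y = (\<Sum>B\<in>Pow {1..d}. c B * (\<Prod>j\<in>B. y j))"
    using assms unfolding multilinear_in_def by blast
  have "f y = (\<Sum>i\<in>multi_idx d. c {j\<in>{1..d}. i j = 1} * (\<Prod>j=1..d. y j ^ i j))" for y
    unfolding c
  proof (rule sum.reindex_bij_witness[of _ "\<lambda>i. {j\<in>{1..d}. i j = 1}"
        "\<lambda>B. \<lambda>j\<in>{1..d}. if j \<in> B then 1 else 0"], goal_cases)
    case (3 i)
    then show ?case by (force simp: multi_idx_def PiE_def Pi_def extensional_def fun_eq_iff)
  next
    case (5 B)
    then have B: "B \<subseteq> {1..d}" by simp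
    have 1: "{j \<in> {1..d}. (\<lambda>j\<in>{1..d}. if j \<in> B then 1 else 0) j = (1::nat)} = B"
      using B by auto
    have 2: "(\<Prod>j=1..d. y j ^ (\<lambda>j\<in>{1..d}. if j \<in> B then 1 else 0) j) = (\<Prod>j\<in>B. y j)"
      using B by (intro prod.mono_neutral_cong_right) auto
    show ?case by (simp only: 1 2)
  qed (auto simp: multi_idx_def)
  then show ?thesis unfolding poly_space_def
    by (intro CollectI exI[of _ "\<lambda>i. c {j\<in>{1..d}. i j = 1}"]) simp
qed

text \<open>Coordinates are put into the open block \<open>s\<close> until its sum reaches
  \<open>r\<close>. Before its last coordinate the sum is below \<open>r\<close>, and that
  coordinate adds at most \<open>C\<close>, so a closed block accounts for at most
  \<open>r + C\<close>.\<close>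

lemma greedy_blocks:
  fixes g :: "nat \<Rightarrow> real"
  assumes "\<And>j. j \<in> {1..d} \<Longrightarrow> 0 \<le> g j \<and> g j \<le> C" "0 < r"
  shows "\<exists>s b. (\<forall>j\<in>{1..d}. b j \<le> s) \<and> (\<forall>k<s. r \<le> (\<Sum>j | j \<in> {1..d} \<and> b j = k. g j)) \<and>
    (\<Sum>j | j \<in> {1..d} \<and> b j = s. g j) < r \<and>
    (\<Sum>j=1..d. g j) \<le> real s * (r + C) + (\<Sum>j | j \<in> {1..d} \<and> b j = (s::nat). g j)"
  using assms(1)
proof (induction d)
  case 0
  show ?case by (intro exI[of _ 0]) (use \<open>0 < r\<close> in simp)
next
  case (Suc d)
  have "\<And>j. j \<in> {1..d} \<Longrightarrow> 0 \<le> g j \<and> g j \<le> C" using Suc.prems by simp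
  from Suc.IH[OF this] obtain s b where b: "\<forall>j\<in>{1..d}. b j \<le> s"
    and full: "\<forall>k<s. r \<le> (\<Sum>j | j \<in> {1..d} \<and> b j = k. g j)"
    and rest: "(\<Sum>j | j \<in> {1..d} \<and> b j = s. g j) < r"
    and total: "(\<Sum>j=1..d. g j) \<le> real s * (r + C) + (\<Sum>j | j \<in> {1..d} \<and> b j = s. g j)"
    by blast
  define b' where "b' = b(Suc d := s)"
  have g: "0 \<le> g (Suc d)" "g (Suc d) \<le> C" using Suc.prems[of "Suc d"] by auto
  have set_s: "{j. j \<in> {1..Suc d} \<and> b' j = s} = insert (Suc d) {j. j \<in> {1..d} \<and> b j = s}"
    by (auto simp: b'_def)
  have set_k: "{j. j \<in> {1..Suc d} \<and> b' j = k} = {j. j \<in> {1..d} \<and> b j = k}" if "k \<noteq> s" for k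
    using that by (auto simp: b'_def)
  have sum_s: "(\<Sum>j | j \<in> {1..Suc d} \<and> b' j = s. g j) = g (Suc d) + (\<Sum>j | j \<in> {1..d} \<and> b j = s. g j)"
    unfolding set_s by (subst sum.insert) auto
  have b': "\<forall>j\<in>{1..Suc d}. b' j \<le> s" using b by (auto simp: b'_def)
  have full': "\<forall>k<s. r \<le> (\<Sum>j | j \<in> {1..Suc d} \<and> b' j = k. g j)"
    using full set_k by auto
  have total': "(\<Sum>j=1..Suc d. g j) \<le> real s * (r + C) + (\<Sum>j | j \<in> {1..Suc d} \<and> b' j = s. g j)"
    using total by (simp only: sum_s) simp
  show ?case
  proof (cases "(\<Sum>j | j \<in> {1..Suc d} \<and> b' j = s. g j) < r")
    case True
    then show ?thesis using b' full' total' by blast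
  next
    case False
    \<comment> \<open>The block \<open>s\<close> has just been closed, and the next open block
      starts empty.\<close>
    have empty: "{j. j \<in> {1..Suc d} \<and> b' j = Suc s} = {}" using b' by force
    have "real (Suc s) * (r + C) = real s * (r + C) + (r + C)" by (simp add: algebra_simps)
    then have "(\<Sum>j=1..Suc d. g j) \<le> real (Suc s) * (r + C)"
      using total' rest g(2) unfolding sum_s by linarith
    moreover have "\<forall>k<Suc s. r \<le> (\<Sum>j | j \<in> {1..Suc d} \<and> b' j = k. g j)"
      using full' False by (auto simp: less_Suc_eq)
    moreover have "\<forall>j\<in>{1..Suc d}. b' j \<le> Suc s" using b' by (simp add: le_SucI)
    moreover have "(\<Sum>j | j \<in> {1..Suc d} \<and> b' j = Suc s. g j) = 0"
      by (simp only: empty sum.empty)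
    ultimately show ?thesis
      using \<open>0 < r\<close> by (intro exI[of _ "Suc s"] exI[of _ b']) (metis add_0_right)
  qed
qed

section \<open>The essential supremum norm on the cube\<close>

lemma space_leb_cube: "space (leb_cube d) = cube d"
  by (simp add: leb_cube_def cube_def space_PiM space_restrict_space)

lemma Linf_norm_le:
  assumes "\<And>x. x \<in> cube d \<Longrightarrow> \<bar>f x\<bar> \<le> B" "0 \<le> B"
  shows "Linf_norm d f \<le> B"
proof (cases "(\<lambda>x. ereal \<bar>f x\<bar>) \<in> borel_measurable (leb_cube d)")
  case True
  have "esssup (leb_cube d) (\<lambda>x. ereal \<bar>f x\<bar>) \<le> ereal B"
    using True by (rule esssup_I) (auto simp: space_leb_cube intro!: AE_I2 assms(1))
  then show ?thesis unfolding Linf_norm_def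
    using assms(2) by (cases "esssup (leb_cube d) (\<lambda>x. ereal \<bar>f x\<bar>)") auto
next
  case False
  \<comment> \<open>For a non-measurable function the essential supremum is
    \<open>\<infinity>\<close>, whose conversion to a real number is 0.\<close>
  then show ?thesis using assms(2) by (simp add: Linf_norm_def esssup_non_measurable top_ereal_def)
qed

text \<open>A negative essential supremum \<open>r\<close> of a nonnegative function would make
  every property hold almost everywhere, so \<open>r - 1\<close> would be an essential bound
  too.\<close>

lemma Linf_norm_nonneg: "0 \<le> Linf_norm d f"
proof (rule ccontr)
  assume neg: "\<not> 0 \<le> Linf_norm d f"
  let ?e = "esssup (leb_cube d) (\<lambda>x. ereal \<bar>f x\<bar>)"
  obtain r where r: "?e = ereal r" "r < 0"
    using neg unfolding Linf_norm_def by (cases ?e) auto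
  then have meas: "(\<lambda>x. ereal \<bar>f x\<bar>) \<in> borel_measurable (leb_cube d)"
    using esssup_non_measurable[of "\<lambda>x. ereal \<bar>f x\<bar>" "leb_cube d"] by (auto simp: top_ereal_def)
  have "AE x in leb_cube d. ereal \<bar>f x\<bar> \<le> ereal r"
    using esssup_AE[of "\<lambda>x. ereal \<bar>f x\<bar>" "leb_cube d"] r(1) by simp
  then have "AE x in leb_cube d. ereal \<bar>f x\<bar> \<le> ereal (r - 1)"
    using r(2) by (auto elim!: AE_mp)
  then have "?e \<le> ereal (r - 1)" by (rule esssup_I[OF meas])
  then show False using r(1) by simp
qed

lemma AE_Linf_norm:
  assumes "f \<in> Linf d"
  shows "AE x in leb_cube d. \<bar>f x\<bar> \<le> Linf_norm d f"
proof -
  let ?e = "esssup (leb_cube d) (\<lambda>x. ereal \<bar>f x\<bar>)"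
  have fin: "?e < \<infinity>" using assms by (simp add: Linf_def)
  have "AE x in leb_cube d. ereal \<bar>f x\<bar> \<le> ?e" by (rule esssup_AE)
  then show ?thesis
  proof (rule AE_mp, intro AE_I2 impI)
    fix x assume "ereal \<bar>f x\<bar> \<le> ?e"
    then show "\<bar>f x\<bar> \<le> Linf_norm d f"
      unfolding Linf_norm_def using fin by (cases ?e) auto
  qed
qed

lemma Linf_diff:
  assumes "f \<in> Linf d" "h \<in> Linf d"
  shows "(\<lambda>x\<in>cube d. f x - h x) \<in> Linf d"
proof -
  have [measurable]: "f \<in> borel_measurable (leb_cube d)" "h \<in> borel_measurable (leb_cube d)"
    using assms by (auto simp: Linf_def)
  have "(\<lambda>x. f x - h x) \<in> borel_measurable (leb_cube d)" by measurable
  then have meas [measurable]: "(\<lambda>x\<in>cube d. f x - h x) \<in> borel_measurable (leb_cube d)"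
    by (rule measurable_cong[THEN iffD1, rotated]) (simp add: space_leb_cube)
  have "AE x in leb_cube d. ereal \<bar>(\<lambda>x\<in>cube d. f x - h x) x\<bar> \<le> ereal (Linf_norm d f + Linf_norm d h)"
    using AE_Linf_norm[OF assms(1)] AE_Linf_norm[OF assms(2)] AE_space
    by eventually_elim (auto simp: space_leb_cube)
  then have "esssup (leb_cube d) (\<lambda>x. ereal \<bar>(\<lambda>x\<in>cube d. f x - h x) x\<bar>) \<le> ereal (Linf_norm d f + Linf_norm d h)"
    by (intro esssup_I) measurable
  then show ?thesis
    using meas by (auto simp: Linf_def intro: le_less_trans)
qed

lemma prod_ennreal_pos:
  fixes f :: "'a \<Rightarrow> ennreal"
  assumes "finite A" "\<And>j. j \<in> A \<Longrightarrow> 0 < f j"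
  shows "0 < prod f A"
  using assms by (induction rule: finite_induct) (auto simp: ennreal_zero_less_mult_iff)

text \<open>This links values at single points, including boundary points of the cube, with
  statements that hold almost everywhere.\<close>

lemma emeasure_cube_neighbourhood_pos:
  assumes v: "v \<in> cube d" and "0 < \<rho>"
  shows "\<exists>Q\<in>sets (leb_cube d). Q \<subseteq> {y \<in> cube d. \<forall>j\<in>{1..d}. \<bar>y j - v j\<bar> < \<rho>} \<and> 0 < emeasure (leb_cube d) Q"
proof -
  \<comment> \<open>Clipping to \<open>[0,1]\<close> covers points \<open>v\<close> on the boundary;
    half the radius leaves room for the strict inequality.\<close>
  define I where "I j = {max 0 (v j - \<rho> / 2)..min 1 (v j + \<rho> / 2)}" for j
  let ?M = "\<lambda>_::nat. restrict_space lborel {0..1::real}"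
  interpret product_sigma_finite ?M
    by (intro product_sigma_finite.intro sigma_finite_measure_restrict_space sigma_finite_lborel) simp
  have vj: "v j \<in> {0..1}" if "j \<in> {1..d}" for j using v that by (auto simp: cube_def)
  have setI: "I j \<in> sets (?M j)" for j
    by (auto simp: sets_restrict_space I_def image_iff intro!: bexI[of _ "I j"])
  have posI: "0 < emeasure (?M j) (I j)" if "j \<in> {1..d}" for j
  proof -
    have "max 0 (v j - \<rho> / 2) < min 1 (v j + \<rho> / 2)"
      using vj[OF that] \<open>0 < \<rho>\<close> by auto
    moreover have "emeasure (?M j) (I j) = emeasure lborel (I j)"
      by (rule emeasure_restrict_space) (auto simp: I_def)
    ultimately show ?thesis by (simp add: I_def)
  qed
  have Q: "PiE {1..d} I \<in> sets (PiM {1..d} ?M)" using setI by (intro sets_PiM_I_finite) auto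
  have "emeasure (PiM {1..d} ?M) (PiE {1..d} I) = (\<Prod>j\<in>{1..d}. emeasure (?M j) (I j))"
    using setI by (intro emeasure_PiM) auto
  also have "\<dots> > 0" using posI by (intro prod_ennreal_pos) auto
  finally have "0 < emeasure (leb_cube d) (PiE {1..d} I)"
    using Q by (simp add: leb_cube_def)
  moreover have "PiE {1..d} I \<in> sets (leb_cube d)"
    using Q by (simp add: leb_cube_def sets_completionI_sets)
  moreover have "PiE {1..d} I \<subseteq> {y \<in> cube d. \<forall>j\<in>{1..d}. \<bar>y j - v j\<bar> < \<rho>}"
  proof
    fix y assume y: "y \<in> PiE {1..d} I"
    have "y j \<in> I j" if "j \<in> {1..d}" for j using y that by auto
    then have "y j \<in> {0..1} \<and> \<bar>y j - v j\<bar> < \<rho>" if "j \<in> {1..d}" for j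
      using that \<open>0 < \<rho>\<close> by (fastforce simp: I_def)
    then show "y \<in> {y \<in> cube d. \<forall>j\<in>{1..d}. \<bar>y j - v j\<bar> < \<rho>}"
      using y by (auto simp: cube_def PiE_def Pi_def)
  qed
  ultimately show ?thesis by blast
qed

text \<open>The triangle inequality through \<open>h\<close> holds almost everywhere only;
  continuity of \<open>f - g\<close> at \<open>v\<close> carries it to that point. It applies to two
  inputs \<open>f\<close> and \<open>g\<close> for which an algorithm returns the same
  \<open>h\<close>.\<close>

lemma pointwise_gap_le_Linf_norms:
  assumes fgh: "f \<in> Linf d" "g \<in> Linf d" "h \<in> Linf d" and v: "v \<in> cube d"
    and cont: "\<And>\<eta>. 0 < \<eta> \<Longrightarrow> \<exists>\<rho>>0. \<forall>y\<in>cube d. (\<forall>j\<in>{1..d}. \<bar>y j - v j\<bar> < \<rho>) \<longrightarrow>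
                  \<bar>(f y - g y) - (f v - g v)\<bar> < \<eta>"
  shows "\<bar>f v - g v\<bar> \<le> Linf_norm d (\<lambda>x\<in>cube d. f x - h x) + Linf_norm d (\<lambda>x\<in>cube d. g x - h x)"
    (is "_ \<le> ?L1 + ?L2")
proof (rule ccontr)
  assume "\<not> ?thesis"
  then obtain \<rho> where \<rho>: "\<rho> > 0" "\<And>y. y \<in> cube d \<Longrightarrow> (\<forall>j\<in>{1..d}. \<bar>y j - v j\<bar> < \<rho>) \<Longrightarrow>
                  \<bar>(f y - g y) - (f v - g v)\<bar> < \<bar>f v - g v\<bar> - (?L1 + ?L2)"
    using cont[of "\<bar>f v - g v\<bar> - (?L1 + ?L2)"] by auto
  obtain Q where Q: "Q \<in> sets (leb_cube d)" "Q \<subseteq> {y \<in> cube d. \<forall>j\<in>{1..d}. \<bar>y j - v j\<bar> < \<rho>}"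
    "0 < emeasure (leb_cube d) Q"
    using emeasure_cube_neighbourhood_pos[OF v \<rho>(1)] by blast
  have "AE x in leb_cube d. \<bar>f x - g x\<bar> \<le> ?L1 + ?L2"
    using AE_Linf_norm[OF Linf_diff[OF fgh(1,3)]] AE_Linf_norm[OF Linf_diff[OF fgh(2,3)]] AE_space
    by eventually_elim (auto simp: space_leb_cube)
  then have "AE x in leb_cube d. x \<notin> Q"
  proof (rule AE_mp, intro AE_I2 impI notI)
    fix x assume "\<bar>f x - g x\<bar> \<le> ?L1 + ?L2" "x \<in> Q"
    then show False using Q(2) \<rho>(2)[of x] by fastforce
  qed
  then have "emeasure (leb_cube d) Q = 0"
    using Q(1) AE_iff_null_sets null_setsD1 by blast
  then show False using Q(3) by simp
qed

section \<open>Block polynomials\<close>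

lemma continuous_on_vertex_interp:
  fixes u :: "'a::topological_space \<Rightarrow> nat \<Rightarrow> real"
  assumes "\<And>k. continuous_on S (\<lambda>y. u y k)"
  shows "continuous_on S (\<lambda>y. vertex_interp s a (u y))"
  by (induction s arbitrary: a) (auto intro!: continuous_intros assms)

text \<open>Each block \<open>k < s\<close> carries a probability vector. Coordinates with
  \<open>b j \<ge> s\<close> form the remainder and do not influence the polynomials below.\<close>

locale weighted_blocks =
  fixes d s :: nat and b :: "nat \<Rightarrow> nat" and w :: "nat \<Rightarrow> real"
  assumes w_nonneg: "j \<in> {1..d} \<Longrightarrow> 0 \<le> w j"
    and w_sum: "k < s \<Longrightarrow> (\<Sum>j | j \<in> {1..d} \<and> b j = k. w j) = 1"
begin

definition block_mean :: "(nat \<Rightarrow> real) \<Rightarrow> nat \<Rightarrow> real" where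
  "block_mean y k = (\<Sum>j | j \<in> {1..d} \<and> b j = k. w j * y j)"

definition block_poly :: "(nat set \<Rightarrow> real) \<Rightarrow> cfun" where
  "block_poly a = (\<lambda>y\<in>cube d. vertex_interp s a (block_mean y))"

lemma block_mean_bounds:
  assumes "y \<in> cube d" "k < s"
  shows "0 \<le> block_mean y k \<and> block_mean y k \<le> 1"
proof
  have y: "0 \<le> y j" "y j \<le> 1" if "j \<in> {1..d}" for j
    using assms(1) that by (auto simp: cube_def)
  show "0 \<le> block_mean y k"
    unfolding block_mean_def using w_nonneg y by (intro sum_nonneg) auto
  have "block_mean y k \<le> (\<Sum>j | j \<in> {1..d} \<and> b j = k. w j * 1)"
    unfolding block_mean_def using w_nonneg y by (intro sum_mono mult_left_mono) auto
  then show "block_mean y k \<le> 1" using w_sum[OF assms(2)] by simp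
qed

lemma abs_block_poly_le:
  assumes "\<And>\<beta>. \<bar>a \<beta>\<bar> \<le> B" "y \<in> cube d"
  shows "\<bar>block_poly a y\<bar> \<le> B"
  using abs_vertex_interp_le[OF assms(1), of s "block_mean y"] block_mean_bounds[OF assms(2)] assms(2)
  by (simp add: block_poly_def)

lemma block_poly_in_poly_space: "block_poly a \<in> poly_space d"
proof -
  have "multilinear_in (\<Union>k<s. {j. j \<in> {1..d} \<and> b j = k})
      (\<lambda>y. vertex_interp s a (\<lambda>k. \<Sum>j | j \<in> {1..d} \<and> b j = k. w j * y j))"
    by (rule multilinear_in_vertex_interp) auto
  then have "multilinear_in {1..d} (\<lambda>y. vertex_interp s a (block_mean y))"
    unfolding block_mean_def by (rule multilinear_in_mono) auto
  then show ?thesis unfolding block_poly_def by (rule multilinear_in_poly_space)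
qed

lemma block_poly_linear:
  "block_poly (\<lambda>\<beta>. c * a \<beta> + e * a' \<beta>) = lincomb (cube d) c (block_poly a) e (block_poly a')"
  by (auto simp: block_poly_def lincomb_def vertex_interp_linear)

text \<open>A point constant on blocks has block means equal to that constant. Hence every
  coefficient indexed by a subset of \<open>{..<s}\<close> is a value of the polynomial, the reverse
  of the bound \<open>abs_block_poly_le\<close>.\<close>

lemma block_poly_vertex:
  assumes "\<beta> \<subseteq> {..<s}"
  shows "block_poly a (\<lambda>j\<in>{1..d}. if b j \<in> \<beta> then 1 else 0) = a \<beta>"
proof -
  let ?v = "\<lambda>j\<in>{1..d}. if b j \<in> \<beta> then 1 else (0::real)"
  have "block_mean ?v k = (if k \<in> \<beta> then 1 else 0)" if "k < s" for k
  proof -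
    have "block_mean ?v k = (\<Sum>j | j \<in> {1..d} \<and> b j = k. if k \<in> \<beta> then w j else 0)"
      unfolding block_mean_def by (intro sum.cong) auto
    then show ?thesis using w_sum[OF that] by simp
  qed
  moreover have "?v \<in> cube d" by (auto simp: cube_def)
  ultimately show ?thesis
    using assms by (simp add: block_poly_def vertex_interp_vertex)
qed

lemma block_poly_continuous:
  assumes v: "v \<in> cube d" and "0 < \<eta>"
  shows "\<exists>\<rho>>0. \<forall>y\<in>cube d. (\<forall>j\<in>{1..d}. \<bar>y j - v j\<bar> < \<rho>) \<longrightarrow> \<bar>block_poly a y - block_poly a v\<bar> < \<eta>"
proof -
  have "continuous_on UNIV (\<lambda>y. vertex_interp s a (block_mean y))"
    unfolding block_mean_def by (intro continuous_on_vertex_interp continuous_intros) simp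
  then have "isCont (\<lambda>y. vertex_interp s a (block_mean y)) v"
    by (simp add: continuous_on_eq_continuous_at)
  from this[unfolded continuous_at_eps_delta, rule_format, OF \<open>0 < \<eta>\<close>]
  obtain \<delta> where \<delta>: "\<delta> > 0" "\<And>y. dist y v < \<delta> \<Longrightarrow>
      dist (vertex_interp s a (block_mean y)) (vertex_interp s a (block_mean v)) < \<eta>"
    by blast
  \<comment> \<open>The radius is \<open>\<delta> / 3\<close> because the product metric costs a
    factor 2.\<close>
  have "\<bar>block_poly a y - block_poly a v\<bar> < \<eta>"
    if y: "y \<in> cube d" "\<forall>j\<in>{1..d}. \<bar>y j - v j\<bar> < \<delta> / 3" for y
  proof -
    have "dist (y j) (v j) \<le> \<delta> / 3" for j
    proof (cases "j \<in> {1..d}")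
      case False
      then have "y j = v j" using y(1) v unfolding cube_def by (metis PiE_arb)
      then show ?thesis using \<open>\<delta> > 0\<close> by simp
    qed (use y(2) in \<open>simp add: dist_real_def less_imp_le\<close>)
    then have "dist y v \<le> 2 * (\<delta> / 3)" by (rule dist_fun_le_coordinates)
    then have "dist y v < \<delta>" using \<open>\<delta> > 0\<close> by simp
    then show ?thesis using \<delta>(2) y(1) v by (simp add: block_poly_def dist_real_def)
  qed
  then show ?thesis using \<delta>(1) by (intro exI[of _ "\<delta> / 3"]) simp
qed

text \<open>Moving \<open>y j\<close> changes only the mean of block \<open>b j\<close>, with slope
  \<open>w j\<close>, so the chain rule reduces the claim to the interpolant. The derivative is
  again a block polynomial, and mixed derivatives become operations on coefficients.\<close>

lemma partial_deriv_block_poly: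
  assumes j: "j \<in> {1..d}"
  shows "partial_deriv d j (block_poly a) =
    block_poly (\<lambda>\<beta>. if b j < s then w j * (a (insert (b j) \<beta>) - a (\<beta> - {b j})) else 0)"
    (is "_ = block_poly ?a'")
proof
  fix y
  show "partial_deriv d j (block_poly a) y = block_poly ?a' y"
  proof (cases "y \<in> cube d")
    case y: True
    let ?k = "b j" and ?u = "block_mean y"
    let ?c = "\<lambda>t. ?u ?k + w j * (t - y j)"
    have mean: "block_mean (y(j := t)) = ?u(?k := ?c t)" for t
    proof
      fix k
      show "block_mean (y(j := t)) k = (?u(?k := ?c t)) k"
      proof (cases "k = ?k")
        case True
        let ?I = "{i. i \<in> {1..d} \<and> b i = ?k}"
        have I: "finite ?I" "j \<in> ?I" using j by auto
        have "block_mean (y(j := t)) ?k = w j * t + (\<Sum>i\<in>?I - {j}. w i * y i)"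
          unfolding block_mean_def by (subst sum.remove[OF I]) (auto intro!: sum.cong)
        moreover have "?u ?k = w j * y j + (\<Sum>i\<in>?I - {j}. w i * y i)"
          unfolding block_mean_def by (subst sum.remove[OF I]) auto
        ultimately show ?thesis using True by (simp add: algebra_simps)
      next
        case False
        then show ?thesis unfolding block_mean_def by (auto intro!: sum.cong)
      qed
    qed
    have upd: "y(j := t) \<in> cube d" if "t \<in> {0..1}" for t
      using y j that by (auto simp: cube_def PiE_def extensional_def)
    have yj: "y j \<in> {0..1}" using y j by (auto simp: cube_def)
    have "((\<lambda>t. vertex_interp s a (?u(?k := ?c t))) has_real_derivative
        vertex_interp s ?a' ?u) (at (y j) within {0..1})"
    proof (cases "?k < s")
      case True
      let ?D = "vertex_interp s (\<lambda>\<beta>. a (insert ?k \<beta>) - a (\<beta> - {?k})) ?u"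
      have "(?c has_real_derivative w j) (at (y j) within {0..1})"
        by (auto intro!: derivative_eq_intros)
      from DERIV_chain2[OF vertex_interp_partial_derivative[OF True, of a ?u] this]
      have "((\<lambda>t. vertex_interp s a (?u(?k := ?c t))) has_real_derivative ?D * w j)
          (at (y j) within {0..1})" .
      moreover have "vertex_interp s ?a' ?u = ?D * w j"
        using True vertex_interp_linear[of s "w j" "\<lambda>\<beta>. a (insert ?k \<beta>) - a (\<beta> - {?k})" 0 "\<lambda>_. 0" ?u]
        by (simp add: mult.commute)
      ultimately show ?thesis by simp
    next
      case False
      have "vertex_interp s a (?u(?k := x)) = vertex_interp s a ?u" for x
        using False by (intro vertex_interp_cong) auto
      moreover have "vertex_interp s ?a' ?u = 0"
        using False vertex_interp_linear[of s 0 "\<lambda>_. 0" 0 "\<lambda>_. 0" ?u] by simp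
      ultimately show ?thesis by simp
    qed
    \<comment> \<open>For \<open>t\<close> outside \<open>[0,1]\<close> the point leaves the cube;
      the two functions are compared only on the interval within which the derivative is
      taken.\<close>
    then have "((\<lambda>t. block_poly a (y(j := t))) has_vector_derivative vertex_interp s ?a' ?u)
        (at (y j) within {0..1})"
      unfolding has_real_derivative_iff_has_vector_derivative
      by (rule has_vector_derivative_transform[OF yj, rotated]) (simp add: block_poly_def upd mean)
    then have "vector_derivative (\<lambda>t. block_poly a (y(j := t))) (at (y j) within {0..1}) =
        vertex_interp s ?a' ?u"
      using yj by (intro vector_derivative_within_closed_interval) auto
    then show ?thesis using y by (simp add: partial_deriv_def block_poly_def)
  qed (simp add: partial_deriv_def block_poly_def)
qed

text \<open>Every partial derivative in direction \<open>j\<close> costs a factor \<open>2 * w j\<close>, so it is the block sums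
  being at least 2 that keep the coefficients below the weights.\<close>

lemma mixed_deriv_block_poly:
  assumes g: "\<And>j. j \<in> {1..d} \<Longrightarrow> 0 \<le> \<gamma> d j" "\<And>j. j \<in> {1..d} \<Longrightarrow> b j < s \<Longrightarrow> 2 * w j \<le> \<gamma> d j"
    and a: "\<And>\<beta>. \<bar>a \<beta>\<bar> \<le> B"
  shows "\<exists>a'. mixed_deriv d \<alpha> (block_poly a) = block_poly a' \<and> (\<forall>\<beta>. \<bar>a' \<beta>\<bar> \<le> prod_weight \<gamma> d \<alpha> * B)"
proof -
  have step: "\<exists>a'. (partial_deriv d j ^^ m) (block_poly a1) = block_poly a' \<and> (\<forall>\<beta>. \<bar>a' \<beta>\<bar> \<le> \<gamma> d j ^ m * B1)"
    if "\<And>\<beta>. \<bar>a1 \<beta>\<bar> \<le> B1" "j \<in> {1..d}" "0 \<le> B1" for j m a1 B1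
  proof (induction m)
    case 0
    then show ?case using that(1) by auto
  next
    case (Suc m)
    then obtain a2 where a2: "(partial_deriv d j ^^ m) (block_poly a1) = block_poly a2"
      "\<And>\<beta>. \<bar>a2 \<beta>\<bar> \<le> \<gamma> d j ^ m * B1" by blast
    define a3 where "a3 \<beta> = (if b j < s then w j * (a2 (insert (b j) \<beta>) - a2 (\<beta> - {b j})) else 0)" for \<beta>
    have "\<bar>a3 \<beta>\<bar> \<le> \<gamma> d j ^ Suc m * B1" for \<beta>
    proof (cases "b j < s")
      case True
      have "\<bar>a2 (insert (b j) \<beta>) - a2 (\<beta> - {b j})\<bar> \<le> 2 * (\<gamma> d j ^ m * B1)"
        using a2(2)[of "insert (b j) \<beta>"] a2(2)[of "\<beta> - {b j}"] by linarith
      then have "\<bar>a3 \<beta>\<bar> \<le> w j * (2 * (\<gamma> d j ^ m * B1))"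
        using True w_nonneg[OF \<open>j \<in> _\<close>] by (simp add: a3_def abs_mult mult_left_mono)
      also have "\<dots> = (2 * w j) * (\<gamma> d j ^ m * B1)" by simp
      also have "\<dots> \<le> \<gamma> d j * (\<gamma> d j ^ m * B1)"
        using g that True by (intro mult_right_mono) auto
      finally show ?thesis by (simp add: mult.assoc)
    next
      case False
      then show ?thesis using g(1) that by (simp add: a3_def)
    qed
    moreover have "(partial_deriv d j ^^ Suc m) (block_poly a1) = block_poly a3"
      unfolding a3_def using partial_deriv_block_poly[OF \<open>j \<in> _\<close>, of a2] a2(1) by simp
    ultimately show ?case by blast
  qed
  have "\<exists>a'. foldr (\<lambda>j. partial_deriv d j ^^ \<alpha> j) js (block_poly a) = block_poly a' \<and>
      (\<forall>\<beta>. \<bar>a' \<beta>\<bar> \<le> (\<Prod>j\<leftarrow>js. \<gamma> d j ^ \<alpha> j) * B)" if "set js \<subseteq> {1..d}" for js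
    using that
  proof (induction js)
    case Nil
    then show ?case using a by auto
  next
    case (Cons j js)
    then obtain a2 where a2: "foldr (\<lambda>j. partial_deriv d j ^^ \<alpha> j) js (block_poly a) = block_poly a2"
      "\<And>\<beta>. \<bar>a2 \<beta>\<bar> \<le> (\<Prod>j\<leftarrow>js. \<gamma> d j ^ \<alpha> j) * B" by auto
    have "0 \<le> (\<Prod>j\<leftarrow>js. \<gamma> d j ^ \<alpha> j) * B"
      using a2(2)[of "{}"] by linarith
    then show ?case using step[OF a2(2), of j "\<alpha> j"] Cons.prems a2(1)
      by (simp add: mult.assoc)
  qed
  from this[of "[1..<Suc d]"] show ?thesis
    unfolding mixed_deriv_def prod_weight_def
    by (simp add: prod.distinct_set_conv_list[symmetric] atLeastLessThanSuc_atLeastAtMost del: upt_Suc)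
qed

text \<open>The coefficients of the derivative of order \<open>\<alpha>\<close> are bounded by the
  weight of \<open>\<alpha>\<close> times \<open>B\<close>, and the division by that weight in the
  norm cancels it.\<close>

lemma poly_norm_block_poly_le:
  assumes g: "\<And>j. j \<in> {1..d} \<Longrightarrow> 0 < \<gamma> d j" "\<And>j. j \<in> {1..d} \<Longrightarrow> b j < s \<Longrightarrow> 2 * w j \<le> \<gamma> d j"
    and a: "\<And>\<beta>. \<bar>a \<beta>\<bar> \<le> B"
  shows "poly_norm \<gamma> d (block_poly a) \<le> B"
proof -
  have B: "0 \<le> B" using a[of "{}"] by linarith
  have "1 / prod_weight \<gamma> d \<alpha> * Linf_norm d (mixed_deriv d \<alpha> (block_poly a)) \<le> B" for \<alpha>
  proof -
    have pos: "0 < prod_weight \<gamma> d \<alpha>"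
      using g(1) by (auto simp: prod_weight_def intro!: prod_pos)
    have "\<exists>a'. mixed_deriv d \<alpha> (block_poly a) = block_poly a' \<and>
        (\<forall>\<beta>. \<bar>a' \<beta>\<bar> \<le> prod_weight \<gamma> d \<alpha> * B)"
      by (rule mixed_deriv_block_poly) (use g a in \<open>auto intro: less_imp_le\<close>)
    then obtain a' where a': "mixed_deriv d \<alpha> (block_poly a) = block_poly a'"
      "\<And>\<beta>. \<bar>a' \<beta>\<bar> \<le> prod_weight \<gamma> d \<alpha> * B" by blast
    have "Linf_norm d (block_poly a') \<le> prod_weight \<gamma> d \<alpha> * B"
      using abs_block_poly_le[OF a'(2)] pos B by (intro Linf_norm_le) auto
    then show ?thesis using pos by (simp add: a'(1) field_simps)
  qed
  moreover have "finite (multi_idx d)" "multi_idx d \<noteq> {}"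
    by (auto simp: multi_idx_def finite_PiE PiE_eq_empty_iff)
  ultimately show ?thesis unfolding poly_norm_def by (subst Max_le_iff) auto
qed

end

section \<open>Minimal errors\<close>

lemma Metric_space_norm_dist:
  assumes nfs: "normed_function_space X V N"
  shows "Metric_space V (norm_dist X V N)"
proof -
  have sub: "V \<subseteq> extensional X" and lin: "\<And>f g a b. f \<in> V \<Longrightarrow> g \<in> V \<Longrightarrow> lincomb X a f b g \<in> V"
    and N0: "\<And>f. f \<in> V \<Longrightarrow> 0 \<le> N f \<and> (N f = 0 \<longleftrightarrow> f = (\<lambda>x\<in>X. 0))"
    and Nsc: "\<And>f a. f \<in> V \<Longrightarrow> N (\<lambda>x\<in>X. a * f x) = \<bar>a\<bar> * N f"
    and Nadd: "\<And>f g. f \<in> V \<Longrightarrow> g \<in> V \<Longrightarrow> N (\<lambda>x\<in>X. f x + g x) \<le> N f + N g"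
    using nfs unfolding normed_function_space_def by auto
  show ?thesis
  proof
    fix f g
    show "0 \<le> norm_dist X V N f g" using lin N0 by (simp add: norm_dist_def)
    show "norm_dist X V N f g = norm_dist X V N g f"
    proof (cases "f \<in> V \<and> g \<in> V")
      case True
      have "lincomb X 1 g (-1) f = (\<lambda>x\<in>X. (-1) * lincomb X 1 f (-1) g x)"
        by (auto simp: lincomb_def)
      then show ?thesis using True Nsc[of "lincomb X 1 f (-1) g" "-1"] lin by (simp add: norm_dist_def)
    qed (auto simp: norm_dist_def)
  next
    fix f g assume fg: "f \<in> V" "g \<in> V"
    have "lincomb X 1 f (-1) g = (\<lambda>x\<in>X. 0) \<longleftrightarrow> f = g"
    proof
      assume eq: "lincomb X 1 f (-1) g = (\<lambda>x\<in>X. 0)"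
      have "f x = g x" if "x \<in> X" for x
        using fun_cong[OF eq, of x] that by (simp add: lincomb_def)
      then show "f = g" using fg sub by (auto intro: extensionalityI)
    qed (auto simp: lincomb_def)
    then show "norm_dist X V N f g = 0 \<longleftrightarrow> f = g" using fg lin N0 by (simp add: norm_dist_def)
  next
    fix f g h assume fgh: "f \<in> V" "g \<in> V" "h \<in> V"
    have "lincomb X 1 f (-1) h = (\<lambda>x\<in>X. lincomb X 1 f (-1) g x + lincomb X 1 g (-1) h x)"
      by (auto simp: lincomb_def)
    then show "norm_dist X V N f h \<le> norm_dist X V N f g + norm_dist X V N g h"
      using fgh lin Nadd by (simp add: norm_dist_def)
  qed
qed

text \<open>This passes from the abstract metric topology of \<open>V\<close> to the topology of the
  parameter space, in which \<open>opposite_faces_meet_fiber\<close> is stated.\<close>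

lemma continuous_on_functional_comp:
  fixes T :: "'b::topological_space \<Rightarrow> 'a \<Rightarrow> real"
  assumes nfs: "normed_function_space X V N" and L: "continuous_functional X V N L"
    and TV: "\<And>x. T x \<in> V"
    and lim: "\<And>x. x \<in> S \<Longrightarrow> ((\<lambda>y. N (lincomb X 1 (T y) (-1) (T x))) \<longlongrightarrow> 0) (at x within S)"
  shows "continuous_on S (\<lambda>x. L (T x))"
  unfolding continuous_on_def
proof
  interpret Metric_space V "norm_dist X V N" by (rule Metric_space_norm_dist[OF nfs])
  fix x assume "x \<in> S"
  then have "limitin mtopology T (T x) (at x within S)"
    using lim[of x] TV by (simp add: limitin_metric_dist_null norm_dist_def)
  then have "limitin euclideanreal (L \<circ> T) (L (T x)) (at x within S)"
    using L unfolding continuous_functional_def by (rule continuous_map_limit[rotated])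
  then show "((\<lambda>x. L (T x)) \<longlongrightarrow> L (T x)) (at x within S)" by (simp add: o_def)
qed

context weighted_blocks
begin

lemma block_poly_scale: "block_poly (\<lambda>\<beta>. c * a \<beta>) = (\<lambda>x\<in>cube d. c * block_poly a x)"
  using block_poly_linear[of c a 0 a] by (simp add: lincomb_def)

text \<open>By homogeneity the bound for coefficients in \<open>[-1,1]\<close> determines all
  others; \<open>r = 0\<close> is separate because the proof divides by \<open>r\<close>.\<close>

lemma norm_block_poly_le:
  assumes nfs: "normed_function_space (cube d) V N" and V: "\<And>a. block_poly a \<in> V"
    and K: "\<And>a. (\<And>\<beta>. \<bar>a \<beta>\<bar> \<le> 1) \<Longrightarrow> N (block_poly a) \<le> K"
    and a: "\<And>\<beta>. \<bar>a \<beta>\<bar> \<le> r"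
  shows "N (block_poly a) \<le> K * r"
proof -
  have scale: "N (block_poly (\<lambda>\<beta>. c * a' \<beta>)) = \<bar>c\<bar> * N (block_poly a')" for c a'
    using nfs V[of a'] unfolding block_poly_scale normed_function_space_def by blast
  show ?thesis
  proof (cases "r = 0")
    case True
    then have "a = (\<lambda>\<beta>. 0 * a \<beta>)" using a by auto
    then have "N (block_poly a) = \<bar>0\<bar> * N (block_poly a)" using scale[of 0 a] by metis
    then show ?thesis using True by simp
  next
    case False
    then have r: "0 < r" using a[of "{}"] by linarith
    have "N (block_poly (\<lambda>\<beta>. a \<beta> / r)) \<le> K" using a r by (intro K) simp
    then show ?thesis using scale[of r "\<lambda>\<beta>. a \<beta> / r"] r by (simp add: mult.commute)
  qed
qed

text \<open>The map \<open>T\<close> sends the cube \<open>[-1,1]^(2 ^ s)\<close> into the unit ball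
  of \<open>V\<close>. Two of its points on opposite faces receive the same answer, although their
  images differ by \<open>2 / K\<close> at some vertex.\<close>

lemma minimal_error_ge:
  assumes nfs: "normed_function_space (cube d) V N" and VL: "V \<subseteq> Linf d"
    and V: "\<And>a. block_poly a \<in> V" and "0 < K"
    and K: "\<And>a. (\<And>\<beta>. \<bar>a \<beta>\<bar> \<le> 1) \<Longrightarrow> N (block_poly a) \<le> K"
    and n: "n < 2 ^ s"
  shows "ereal (1 / K) \<le> minimal_error d V N n"
proof -
  let ?m = "2 ^ s :: nat"
  \<comment> \<open>A numbering of the \<open>2 ^ s\<close> vertices, turning coordinate vectors
    into coefficients.\<close>
  obtain idx where idx: "bij_betw idx (Pow {..<s}) {..<?m}"
    using finite_same_card_bij[of "Pow {..<s}" "{..<?m}"] by (auto simp: card_Pow)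
  define T where "T x = block_poly (\<lambda>\<beta>. x (idx \<beta>) / K)" for x
  have TV: "T x \<in> V" for x unfolding T_def by (rule V)
  have coord: "\<bar>x i\<bar> \<le> 1" if "x \<in> symm_box ?m" for x i
    using that by (cases "i < ?m") (auto simp: symm_box_def)
  have T1: "N (T x) \<le> 1" if "x \<in> symm_box ?m" for x
  proof -
    have "N (T x) \<le> K * (1 / K)" unfolding T_def
      by (rule norm_block_poly_le[OF nfs V K]) (use coord[OF that] \<open>0 < K\<close> in \<open>simp_all add: divide_right_mono\<close>)
    then show ?thesis using \<open>0 < K\<close> by simp
  qed
  have lincomb_T: "lincomb (cube d) c (T x) e (T y) = T (\<lambda>i. c * x i + e * y i)" for c e x y
    unfolding T_def block_poly_linear[symmetric] by (simp add: add_divide_distrib)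
  have cont_comp: "continuous_on (symm_box ?m) (\<lambda>x. L (T x))" if "continuous_functional (cube d) V N L" for L
  proof (rule continuous_on_functional_comp[OF nfs that TV])
    fix x assume x: "x \<in> symm_box ?m"
    \<comment> \<open>The sum of the coordinate differences dominates each of them and is continuous
      in the product topology.\<close>
    let ?r = "\<lambda>y :: nat \<Rightarrow> real. \<Sum>i<?m. \<bar>y i - x i\<bar>"
    have "continuous_on (symm_box ?m) ?r"
      by (intro continuous_intros continuous_on_subset[OF continuous_on_product_coordinates subset_UNIV])
    then have "(?r \<longlongrightarrow> ?r x) (at x within symm_box ?m)"
      using x unfolding continuous_on_def by blast
    then have r0: "(?r \<longlongrightarrow> 0) (at x within symm_box ?m)" by simp
    have "norm (N (lincomb (cube d) 1 (T y) (-1) (T x))) \<le> ?r y" if y: "y \<in> symm_box ?m" for y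
    proof -
      have le: "\<bar>y i - x i\<bar> \<le> ?r y" for i
      proof (cases "i < ?m")
        case True
        then show ?thesis by (intro member_le_sum) auto
      next
        case False
        then show ?thesis using x y by (simp add: symm_box_def sum_nonneg)
      qed
      have "N (T (\<lambda>i. 1 * y i + (-1) * x i)) \<le> K * (?r y / K)" unfolding T_def
        by (rule norm_block_poly_le[OF nfs V K]) (use le \<open>0 < K\<close> in \<open>simp_all add: divide_right_mono\<close>)
      moreover have "0 \<le> N (T (\<lambda>i. 1 * y i + (-1) * x i))"
        using nfs TV unfolding normed_function_space_def by blast
      ultimately show ?thesis using \<open>0 < K\<close> by (simp add: lincomb_T)
    qed
    then have "\<forall>\<^sub>F y in at x within symm_box ?m. norm (N (lincomb (cube d) 1 (T y) (-1) (T x))) \<le> ?r y"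
      unfolding eventually_at_filter by (intro always_eventually) blast
    then show "((\<lambda>y. N (lincomb (cube d) 1 (T y) (-1) (T x))) \<longlongrightarrow> 0) (at x within symm_box ?m)"
      using r0 by (rule Lim_null_comparison)
  qed
  have fooled: "ereal (1 / K) \<le> (SUP f \<in> {f \<in> V. N f \<le> 1}. ereal (Linf_norm d (\<lambda>x\<in>cube d. f x - A f x)))"
    if xy: "x \<in> symm_box ?m" "y \<in> symm_box ?m" "i < ?m" "x i = -1" "y i = 1"
      and A: "A (T x) = h" "A (T y) = h" "h \<in> Linf d" for A h x y i
  proof -
    obtain \<beta> where \<beta>: "\<beta> \<subseteq> {..<s}" "idx \<beta> = i"
      using idx xy(3) unfolding bij_betw_def by (metis PowD imageE lessThan_iff)
    define v where "v = (\<lambda>j\<in>{1..d}. if b j \<in> \<beta> then 1 else (0::real))"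
    have v: "v \<in> cube d" by (auto simp: cube_def v_def)
    have Tv: "T z v = z i / K" for z
      unfolding T_def v_def block_poly_vertex[OF \<beta>(1)] \<beta>(2) ..
    have "\<bar>T x v - T y v\<bar> \<le> Linf_norm d (\<lambda>z\<in>cube d. T x z - h z) + Linf_norm d (\<lambda>z\<in>cube d. T y z - h z)"
    proof (rule pointwise_gap_le_Linf_norms[OF _ _ A(3) v])
      show "T x \<in> Linf d" "T y \<in> Linf d" using TV VL by auto
      fix \<eta> :: real assume "0 < \<eta>"
      have "T x z - T y z = T (\<lambda>i. 1 * x i + (-1) * y i) z" if "z \<in> cube d" for z
        using that unfolding lincomb_T[symmetric] by (simp add: lincomb_def)
      then show "\<exists>\<rho>>0. \<forall>z\<in>cube d. (\<forall>j\<in>{1..d}. \<bar>z j - v j\<bar> < \<rho>) \<longrightarrow>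
          \<bar>T x z - T y z - (T x v - T y v)\<bar> < \<eta>"
        using block_poly_continuous[OF v \<open>0 < \<eta>\<close>, of "\<lambda>\<beta>. (1 * x (idx \<beta>) + (-1) * y (idx \<beta>)) / K"] v
        unfolding T_def by simp
    qed
    moreover have "\<bar>T x v - T y v\<bar> = 2 / K" using xy \<open>0 < K\<close> by (simp add: Tv)
    \<comment> \<open>The two errors add up to at least \<open>2 / K\<close>, so one of them is at
      least \<open>1 / K\<close>.\<close>
    ultimately have "\<exists>z\<in>{x, y}. 1 / K \<le> Linf_norm d (\<lambda>u\<in>cube d. T z u - A (T z) u)"
      unfolding bex_simps A(1,2) by (simp add: A(1,2)) argo
    then obtain z where z: "z \<in> {x, y}" "1 / K \<le> Linf_norm d (\<lambda>u\<in>cube d. T z u - A (T z) u)" by blast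
    then have "T z \<in> {f \<in> V. N f \<le> 1}" using TV T1 xy by auto
    then show ?thesis using z(2) by (intro SUP_upper2) auto
  qed
  show ?thesis
    unfolding minimal_error_def
  proof (rule INF_greatest)
    fix A assume "A \<in> algs_cont d V N n \<union> algs_adapt d V N n"
    then consider (cont) "A \<in> algs_cont d V N n" | (adapt) "A \<in> algs_adapt d V N n" by blast
    then show "ereal (1 / K) \<le> (SUP f \<in> {f \<in> V. N f \<le> 1}. ereal (Linf_norm d (\<lambda>x\<in>cube d. f x - A f x)))"
    proof cases
      case cont
      then obtain \<phi> L where A: "A = (\<lambda>f. \<phi> (map (\<lambda>j. L j f) [1..<Suc n]))"
        and \<phi>: "\<And>ys. length ys = n \<Longrightarrow> \<phi> ys \<in> Linf d"
        and L: "\<And>j. j \<in> {1..n} \<Longrightarrow> continuous_functional (cube d) V N (L j)"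
        unfolding algs_cont_def by auto
      have "continuous_on (symm_box ?m) (\<lambda>x. L (Suc j) (T x))" if "j < n" for j
        using that by (intro cont_comp L) simp
      then obtain x y i where xy: "x \<in> symm_box ?m" "y \<in> symm_box ?m" "i < ?m" "x i = -1" "y i = 1"
        and eq: "\<forall>j<n. L (Suc j) (T x) = L (Suc j) (T y)"
        using opposite_faces_meet_fiber[where N = "\<lambda>x j. L (Suc j) (T x)", OF _ n] by blast
      have "L j (T x) = L j (T y)" if "j \<in> {1..n}" for j
        using eq that by (cases j) auto
      then have "map (\<lambda>j. L j (T x)) [1..<Suc n] = map (\<lambda>j. L j (T y)) [1..<Suc n]"
        by (intro map_cong) auto
      then show ?thesis
        by (intro fooled[OF xy, of A "\<phi> (map (\<lambda>j. L j (T x)) [1..<Suc n])"]) (simp_all only: A, simp add: \<phi>)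
    next
      case adapt
      then obtain \<phi> L where A: "A = (\<lambda>f. \<phi> (adapt_info L n f))"
        and \<phi>: "\<And>ys. length ys = n \<Longrightarrow> \<phi> ys \<in> Linf d"
        and L: "\<And>ys. length ys < n \<Longrightarrow> linear_functional (cube d) V (L ys) \<and>
            continuous_functional (cube d) V N (L ys)"
        unfolding algs_adapt_def by auto
      \<comment> \<open>Along the all-zero answers the adaptive choice of functionals is a fixed
        list, to which the face lemma applies.\<close>
      have "continuous_on (symm_box ?m) (\<lambda>x. L (replicate j 0) (T x))" if "j < n" for j
        using that L by (intro cont_comp) simp
      then obtain x y i where xy: "x \<in> symm_box ?m" "y \<in> symm_box ?m" "i < ?m" "x i = -1" "y i = 1"
        and eq: "\<forall>j<n. L (replicate j 0) (T x) = L (replicate j 0) (T y)"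
        using opposite_faces_meet_fiber[where N = "\<lambda>x j. L (replicate j 0) (T x)", OF _ n] by blast
      \<comment> \<open>By linearity the functionals met along the all-zero answers vanish at half the difference,
        so the adaptive algorithm cannot tell it from its negative.\<close>
      define z where "z c = (\<lambda>i. (- c / 2) * x i + (c / 2) * y i)" for c :: real
      have zbox: "z c \<in> symm_box ?m" if "\<bar>c\<bar> = 1" for c
      proof -
        have "\<bar>z c i\<bar> \<le> 1" for i
        proof -
          have "\<bar>z c i\<bar> = \<bar>c\<bar> * \<bar>y i - x i\<bar> / 2"
            unfolding abs_mult[symmetric] by (simp add: z_def field_simps)
          then show ?thesis using coord[OF xy(1), of i] coord[OF xy(2), of i] that by simp
        qed
        moreover have "\<forall>i\<ge>?m. z c i = 0" using xy(1,2) by (simp add: z_def symm_box_def)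
        ultimately show ?thesis by (simp add: symm_box_def)
      qed
      have L0: "L (replicate j 0) (T (z c)) = 0" if "j < n" for j c
      proof -
        have "L (replicate j 0) (T (z c)) = (- c / 2) * L (replicate j 0) (T x) + (c / 2) * L (replicate j 0) (T y)"
          unfolding z_def lincomb_T[symmetric] using L[of "replicate j 0"] TV that
          by (simp add: linear_functional_def)
        then show ?thesis using eq that by simp
      qed
      have info: "adapt_info L k (T (z c)) = replicate k 0" if "k \<le> n" for k c
        using that by (induction k) (auto simp: L0 replicate_append_same)
      show ?thesis
      proof (rule fooled[of "z (-1)" "z 1" i A "\<phi> (replicate n 0)"])
        show "z (-1) \<in> symm_box ?m" "z 1 \<in> symm_box ?m" by (simp_all add: zbox)
        show "z (-1) i = -1" "z 1 i = 1" using xy by (simp_all add: z_def)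
        show "A (T (z (-1))) = \<phi> (replicate n 0)" "A (T (z 1)) = \<phi> (replicate n 0)"
          by (simp_all add: A info)
        show "\<phi> (replicate n 0) \<in> Linf d" by (simp add: \<phi>)
      qed (rule xy)
    qed
  qed
qed

end

lemma n_wor_ge:
  assumes "\<And>n. n < m \<Longrightarrow> ereal \<epsilon> < minimal_error d V N n"
  shows "enat m \<le> n_wor \<epsilon> d V N"
  unfolding n_wor_def
proof (rule Inf_greatest)
  fix e assume "e \<in> {enat n | n. minimal_error d V N n \<le> ereal \<epsilon>}"
  then obtain n where "e = enat n" "minimal_error d V N n \<le> ereal \<epsilon>" by blast
  then show "enat m \<le> e" using assms[of n] by (meson enat_ord_simps(1) leI leD)
qed

section \<open>Information complexity and tractability\<close>

lemma poly_norm_nonneg: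
  assumes "\<And>j. j \<in> {1..d} \<Longrightarrow> 0 \<le> \<gamma> d j"
  shows "0 \<le> poly_norm \<gamma> d f"
proof -
  have fin: "finite (multi_idx d)" and "multi_idx d \<noteq> {}"
    by (auto simp: multi_idx_def finite_PiE PiE_eq_empty_iff)
  then obtain \<alpha> where "\<alpha> \<in> multi_idx d" by blast
  then have "1 / prod_weight \<gamma> d \<alpha> * Linf_norm d (mixed_deriv d \<alpha> f) \<le> poly_norm \<gamma> d f"
    unfolding poly_norm_def using fin by (intro Max_ge) auto
  moreover have "0 \<le> prod_weight \<gamma> d \<alpha>"
    using assms by (auto simp: prod_weight_def intro!: prod_nonneg)
  then have "0 \<le> 1 / prod_weight \<gamma> d \<alpha> * Linf_norm d (mixed_deriv d \<alpha> f)"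
    by (simp add: Linf_norm_nonneg)
  ultimately show ?thesis by linarith
qed

text \<open>Coefficients in \<open>[-1,1]\<close> give block polynomials in the unit ball of the
  polynomial space, hence of norm at most \<open>E\<close> in \<open>V\<close>; so
  \<open>minimal_error_ge\<close> applies with \<open>K = E\<close>.\<close>

lemma n_wor_lower_bound:
  assumes d: "1 \<le> d" and \<gamma>: "\<And>j. j \<in> {1..d} \<Longrightarrow> 0 < \<gamma> d j \<and> \<gamma> d j \<le> C"
    and banach: "banach_function_space (cube d) V N" and VL: "V \<subseteq> Linf d"
    and emb: "continuously_embedded (poly_space d) (poly_norm \<gamma> d) V N"
  defines "E \<equiv> embedding_norm (poly_space d) (poly_norm \<gamma> d) N"
  shows "0 < E"
    and "\<And>\<epsilon>. 0 < \<epsilon> \<Longrightarrow> \<epsilon> < inverse E \<Longrightarrow>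
      ereal (1 / 2 * 2 powr (1 / (2 + C) * (\<Sum>j=1..d. \<gamma> d j))) < ereal_of_enat (n_wor \<epsilon> d V N)"
proof -
  have "\<And>j. j \<in> {1..d} \<Longrightarrow> 0 \<le> \<gamma> d j \<and> \<gamma> d j \<le> C" using \<gamma> by (simp add: less_imp_le)
  from greedy_blocks[where r = 2 and g = "\<gamma> d" and d = d, OF this] obtain s b
    where full: "\<forall>k<s. 2 \<le> (\<Sum>j | j \<in> {1..d} \<and> b j = k. \<gamma> d j)"
      and rest: "(\<Sum>j | j \<in> {1..d} \<and> b j = s. \<gamma> d j) < 2"
      and total: "(\<Sum>j=1..d. \<gamma> d j) \<le> real s * (2 + C) + (\<Sum>j | j \<in> {1..d} \<and> b j = s. \<gamma> d j)"
    by auto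
  define \<sigma> where "\<sigma> k = (\<Sum>j | j \<in> {1..d} \<and> b j = k. \<gamma> d j)" for k
  \<comment> \<open>The weights are normalised within each block; a block sum of at least 2 then
    becomes \<open>2 * w j \<le> \<gamma> d j\<close>.\<close>
  define w where "w j = \<gamma> d j / \<sigma> (b j)" for j
  have \<sigma>: "2 \<le> \<sigma> k" if "k < s" for k using full that by (simp add: \<sigma>_def)
  interpret weighted_blocks d s b w
  proof
    fix j assume j: "j \<in> {1..d}"
    have "0 \<le> \<sigma> (b j)" unfolding \<sigma>_def using \<gamma> by (intro sum_nonneg) (auto simp: less_imp_le)
    then show "0 \<le> w j" using \<gamma>[OF j] by (simp add: w_def)
  next
    fix k assume k: "k < s"
    have "(\<Sum>j | j \<in> {1..d} \<and> b j = k. w j) = (\<Sum>j | j \<in> {1..d} \<and> b j = k. \<gamma> d j / \<sigma> k)"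
      by (intro sum.cong) (auto simp: w_def)
    also have "\<dots> = \<sigma> k / \<sigma> k" unfolding \<sigma>_def by (rule sum_divide_distrib[symmetric])
    finally show "(\<Sum>j | j \<in> {1..d} \<and> b j = k. w j) = 1" using \<sigma>[OF k] by simp
  qed
  have w: "2 * w j \<le> \<gamma> d j" if "j \<in> {1..d}" "b j < s" for j
  proof -
    have "\<gamma> d j * 2 \<le> \<gamma> d j * \<sigma> (b j)"
      using \<gamma>[OF that(1)] \<sigma>[OF that(2)] by (intro mult_left_mono) auto
    then show ?thesis using \<sigma>[OF that(2)] by (simp add: w_def divide_le_eq mult.commute)
  qed
  have norm1: "poly_norm \<gamma> d (block_poly a) \<le> 1" if "\<And>\<beta>. \<bar>a \<beta>\<bar> \<le> 1" for a
    by (rule poly_norm_block_poly_le) (use \<gamma> w that in auto)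
  have V: "block_poly a \<in> V" for a
    using emb block_poly_in_poly_space by (auto simp: continuously_embedded_def)
  have nfs: "normed_function_space (cube d) V N"
    using banach by (simp add: banach_function_space_def)
  \<comment> \<open>The supremum defining \<open>E\<close> bounds its members only if the set is
    bounded above. The constant of the continuous embedding ensures this; its absolute value is
    taken as its sign is unknown.\<close>
  have bdd: "bdd_above (N ` {f \<in> poly_space d. poly_norm \<gamma> d f \<le> 1})"
  proof -
    obtain K where K: "\<forall>f\<in>poly_space d. N f \<le> K * poly_norm \<gamma> d f" and sub: "poly_space d \<subseteq> V"
      using emb by (auto simp: continuously_embedded_def)
    have "N f \<le> \<bar>K\<bar>" if f: "f \<in> poly_space d" "poly_norm \<gamma> d f \<le> 1" for f
    proof -
      have "0 \<le> poly_norm \<gamma> d f" using \<gamma> by (intro poly_norm_nonneg) (simp add: less_imp_le)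
      then have "K * poly_norm \<gamma> d f \<le> \<bar>K\<bar> * 1" using f by (intro mult_mono) auto
      then show ?thesis using K f by fastforce
    qed
    then show ?thesis by (intro bdd_aboveI2[of _ _ "\<bar>K\<bar>"]) auto
  qed
  have NE: "N (block_poly a) \<le> E" if "\<And>\<beta>. \<bar>a \<beta>\<bar> \<le> 1" for a
    unfolding E_def embedding_norm_def
    using norm1[OF that] block_poly_in_poly_space by (intro cSUP_upper bdd) auto
  show E: "0 < E"
  proof -
    \<comment> \<open>Having the value 1 at a vertex, this polynomial is nonzero, which makes
      \<open>E\<close> positive.\<close>
    let ?f = "block_poly (\<lambda>_. 1)"
    have "?f \<noteq> (\<lambda>x\<in>cube d. 0)"
    proof
      assume "?f = (\<lambda>x\<in>cube d. 0)"
      then have "?f (\<lambda>j\<in>{1..d}. if b j \<in> {} then 1 else 0) = 0"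
        by (simp add: cube_def)
      then show False by (subst (asm) block_poly_vertex) auto
    qed
    then have "0 < N ?f" using nfs V unfolding normed_function_space_def by (metis less_eq_real_def)
    also have "\<dots> \<le> E" by (rule NE) simp
    finally show ?thesis .
  qed
  fix \<epsilon> :: real assume \<epsilon>: "0 < \<epsilon>" "\<epsilon> < inverse E"
  have "enat (2 ^ s) \<le> n_wor \<epsilon> d V N"
  proof (rule n_wor_ge)
    fix n :: nat assume "n < 2 ^ s"
    from minimal_error_ge[OF nfs VL V E NE this] \<epsilon>(2) show "ereal \<epsilon> < minimal_error d V N n"
      by (metis ereal_less_eq(3) inverse_eq_divide less_ereal.simps(1) less_le_trans)
  qed
  then have "ereal (2 ^ s) \<le> ereal_of_enat (n_wor \<epsilon> d V N)"
    by (metis ereal_of_enat_le_iff ereal_of_enat_simps(1) of_nat_numeral of_nat_power)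
  moreover have "1 / 2 * 2 powr (1 / (2 + C) * (\<Sum>j=1..d. \<gamma> d j)) < 2 ^ s"
  proof -
    have "0 < C" using \<gamma>[of 1] d by auto
    \<comment> \<open>The remainder weighs less than 2, hence less than \<open>2 + C\<close>. This
      costs less than one unit in the exponent and is the origin of the factor
      \<open>1 / 2\<close>.\<close>
    have "(\<Sum>j=1..d. \<gamma> d j) < (real s + 1) * (2 + C)"
      using total rest \<open>0 < C\<close> by (simp add: algebra_simps)
    then have "1 / (2 + C) * (\<Sum>j=1..d. \<gamma> d j) < real s + 1"
      using \<open>0 < C\<close> by (simp add: divide_less_eq)
    then have "2 powr (1 / (2 + C) * (\<Sum>j=1..d. \<gamma> d j)) < 2 powr (real s + 1)" by simp
    also have "\<dots> = 2 * 2 ^ s" by (simp add: powr_add powr_realpow)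
    finally show ?thesis by simp
  qed
  ultimately show "ereal (1 / 2 * 2 powr (1 / (2 + C) * (\<Sum>j=1..d. \<gamma> d j))) < ereal_of_enat (n_wor \<epsilon> d V N)"
    by (meson ereal_less(1) less_ereal.simps(1) less_le_trans)
qed

text \<open>The lower bound and the tractability bound are compared at one \<open>\<epsilon>\<close>
  below \<open>inverse (E d)\<close>, of order \<open>d\<close> to the power \<open>- q1\<close>.
  Taking logarithms bounds the weight sum, and both exponents enter only the coefficient
  \<open>B\<close>.\<close>

lemma weight_sum_le_of_tractable:
  fixes \<gamma> :: "nat \<Rightarrow> nat \<Rightarrow> real" and E :: "nat \<Rightarrow> real"
  assumes "0 < C"
    and lower: "\<And>d \<epsilon>. 1 \<le> d \<Longrightarrow> 0 < \<epsilon> \<Longrightarrow> \<epsilon> < inverse (E d) \<Longrightarrow>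
      ereal (1 / 2 * 2 powr (1 / C * (\<Sum>j=1..d. \<gamma> d j))) < ereal_of_enat (n_wor \<epsilon> d (F d) (nrm d))"
    and E: "\<And>d. 1 \<le> d \<Longrightarrow> 0 < E d" "\<And>d. 1 \<le> d \<Longrightarrow> E d \<le> c * real d powr q1"
    and "0 \<le> q1" and tract: "tractable_with_exponent F nrm q"
  shows "\<exists>A B. (q1 = 0 \<and> q = 0 \<longrightarrow> B = 0) \<and> (\<forall>d\<ge>1. (\<Sum>j=1..d. \<gamma> d j) \<le> A + B * ln (real d))"
proof -
  obtain C' p where "0 < C'" "0 < p" and upper: "\<And>\<epsilon> d. 0 < \<epsilon> \<Longrightarrow> \<epsilon> \<le> 1 \<Longrightarrow> 1 \<le> d \<Longrightarrow>
      ereal_of_enat (n_wor \<epsilon> d (F d) (nrm d)) \<le> ereal (C' * \<epsilon> powr (- p) * real d powr q)"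
    using tract unfolding tractable_with_exponent_def by blast
  \<comment> \<open>This constant exceeds \<open>c\<close>, which puts \<open>\<epsilon>\<close>
    strictly below \<open>inverse (E d)\<close>, and is at least 2, which gives
    \<open>\<epsilon> \<le> 1\<close>.\<close>
  define c' where "c' = 2 * max 1 c"
  have c': "2 \<le> c'" "c < c'" by (auto simp: c'_def)
  define A where "A = C / ln 2 * (ln 2 + ln C' + p * ln c')"
  define B where "B = C / ln 2 * (p * q1 + q)"
  have "(\<Sum>j=1..d. \<gamma> d j) \<le> A + B * ln (real d)" if d: "1 \<le> d" for d
  proof -
    let ?S = "\<Sum>j=1..d. \<gamma> d j"
    define \<epsilon> where "\<epsilon> = 1 / (c' * real d powr q1)"
    have dq: "1 \<le> real d powr q1" using d \<open>0 \<le> q1\<close> by (simp add: ge_one_powr_ge_zero)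
    have "2 * 1 \<le> c' * real d powr q1" using c' dq by (intro mult_mono) auto
    then have \<epsilon>: "0 < \<epsilon>" "\<epsilon> \<le> 1" by (simp_all add: \<epsilon>_def)
    have "c * real d powr q1 < c' * real d powr q1" using c' d by (intro mult_strict_right_mono) auto
    then have "E d < c' * real d powr q1" using E(2)[OF d] by linarith
    then have "\<epsilon> < inverse (E d)" using E(1)[OF d] unfolding \<epsilon>_def inverse_eq_divide
      by (intro divide_strict_left_mono) (auto intro: mult_pos_pos less_trans)
    from less_le_trans[OF lower[OF d \<epsilon>(1) this] upper[OF \<epsilon> d]]
    have "1 / 2 * 2 powr (1 / C * ?S) < C' * \<epsilon> powr (- p) * real d powr q" by simp
    then have "2 powr (1 / C * ?S) < 2 * (C' * \<epsilon> powr (- p) * real d powr q)" by simp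
    then have "ln (2 powr (1 / C * ?S)) < ln (2 * (C' * \<epsilon> powr (- p) * real d powr q))"
      by (rule ln_less_cancel_iff[THEN iffD2, rotated 2]) (use \<open>0 < C'\<close> \<epsilon> d in auto)
    also have "\<dots> = ln 2 + ln C' + ln (\<epsilon> powr (- p)) + ln (real d powr q)"
      using \<open>0 < C'\<close> \<epsilon> d by (simp add: ln_mult)
    also have "ln (\<epsilon> powr (- p)) = p * (ln c' + q1 * ln (real d))"
      using c' d by (simp add: \<epsilon>_def ln_powr ln_div ln_mult algebra_simps)
    finally have "?S * (ln 2 / C) < ln 2 + ln C' + p * (ln c' + q1 * ln (real d)) + q * ln (real d)"
      using d by (simp add: ln_powr)
    then have "?S < (ln 2 + ln C' + p * (ln c' + q1 * ln (real d)) + q * ln (real d)) * (C / ln 2)"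
      using \<open>0 < C\<close> by (simp add: field_simps)
    also have "\<dots> = A + B * ln (real d)"
      unfolding A_def B_def by (simp add: algebra_simps add_divide_distrib)
    finally show ?thesis by simp
  qed
  moreover have "q1 = 0 \<and> q = 0 \<longrightarrow> B = 0" by (simp add: B_def)
  ultimately show ?thesis by blast
qed

section \<open>From bounds on the weight sums to the sum exponents, with \<open>\<kappa> = 1\<close>
  as the witness\<close>

lemma sum_exp_p_le_one:
  assumes "\<And>d j. 1 \<le> j \<Longrightarrow> j \<le> d \<Longrightarrow> 0 < \<gamma> d j" and "\<And>d. 1 \<le> d \<Longrightarrow> (\<Sum>j=1..d. \<gamma> d j) \<le> A"
  shows "sum_exp_p \<gamma> \<le> 1"
proof -
  have "\<forall>\<^sub>F d in sequentially. ereal (\<Sum>j=1..d. \<gamma> d j powr 1) \<le> ereal A"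
    unfolding eventually_sequentially
  proof (intro exI allI impI)
    fix d :: nat assume "1 \<le> d"
    moreover have "(\<Sum>j=1..d. \<gamma> d j powr 1) = (\<Sum>j=1..d. \<gamma> d j)"
      using assms(1) by (intro sum.cong) (auto simp: less_imp_le)
    ultimately show "ereal (\<Sum>j=1..d. \<gamma> d j powr 1) \<le> ereal A" using assms(2) by simp
  qed
  then have "limsup (\<lambda>d. ereal (\<Sum>j=1..d. \<gamma> d j powr 1)) \<le> ereal A" by (rule Limsup_bounded)
  then have "limsup (\<lambda>d. ereal (\<Sum>j=1..d. \<gamma> d j powr 1)) < \<infinity>" by (rule le_less_trans) simp
  then show ?thesis unfolding sum_exp_p_def one_ereal_def
    by (intro Inf_lower CollectI exI[of _ 1]) simp
qed

lemma sum_exp_q_le_one: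
  assumes "\<And>d j. 1 \<le> j \<Longrightarrow> j \<le> d \<Longrightarrow> 0 < \<gamma> d j"
    and "\<And>d. 1 \<le> d \<Longrightarrow> (\<Sum>j=1..d. \<gamma> d j) \<le> A + B * ln (real d)"
  shows "sum_exp_q \<gamma> \<le> 1"
proof -
  \<comment> \<open>As \<open>ln 2 \<le> ln (real d + 1)\<close> for \<open>d \<ge> 1\<close>, the
    constant term is absorbed into the logarithm; absolute values allow for either sign of
    \<open>A\<close> and \<open>B\<close>.\<close>
  let ?K = "\<bar>A\<bar> / ln 2 + \<bar>B\<bar>"
  have "\<forall>\<^sub>F d in sequentially. ereal (\<Sum>j=1..d. \<gamma> d j powr 1 / ln (real d + 1)) \<le> ereal ?K"
    unfolding eventually_sequentially
  proof (intro exI allI impI)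
    fix d :: nat assume d: "1 \<le> d"
    have ln_pos: "0 < ln (real d + 1)" using d by simp
    have "(\<Sum>j=1..d. \<gamma> d j powr 1 / ln (real d + 1)) = (\<Sum>j=1..d. \<gamma> d j) / ln (real d + 1)"
      unfolding sum_divide_distrib using assms(1) by (intro sum.cong) (auto simp: less_imp_le)
    also have "\<dots> \<le> (?K * ln (real d + 1)) / ln (real d + 1)"
    proof (rule divide_right_mono)
      have "\<bar>A\<bar> / ln 2 * ln 2 \<le> \<bar>A\<bar> / ln 2 * ln (real d + 1)"
        using d by (intro mult_left_mono) auto
      moreover have "B * ln (real d) \<le> \<bar>B\<bar> * ln (real d + 1)"
        using d by (intro mult_mono) auto
      ultimately show "(\<Sum>j=1..d. \<gamma> d j) \<le> ?K * ln (real d + 1)"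
        using assms(2)[OF d] by (simp add: distrib_right)
    qed (use ln_pos in simp)
    finally show "ereal (\<Sum>j=1..d. \<gamma> d j powr 1 / ln (real d + 1)) \<le> ereal ?K" using ln_pos by simp
  qed
  then have "limsup (\<lambda>d. ereal (\<Sum>j=1..d. \<gamma> d j powr 1 / ln (real d + 1))) \<le> ereal ?K" by (rule Limsup_bounded)
  then have "limsup (\<lambda>d. ereal (\<Sum>j=1..d. \<gamma> d j powr 1 / ln (real d + 1))) < \<infinity>" by (rule le_less_trans) simp
  then show ?thesis unfolding sum_exp_q_def one_ereal_def
    by (intro Inf_lower CollectI exI[of _ 1]) simp
qed

theorem proposition4p6:
  fixes \<gamma> :: "nat \<Rightarrow> nat \<Rightarrow> real" and C\<^sub>\<gamma> c q\<^sub>1 :: real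
    and F :: "nat \<Rightarrow> cfun set" and nrm :: "nat \<Rightarrow> cfun \<Rightarrow> real"
  assumes "\<And>d. 1 \<le> d \<Longrightarrow> \<gamma> d 1 \<le> C\<^sub>\<gamma>"
    and "\<And>d j. 1 \<le> j \<Longrightarrow> j < d \<Longrightarrow> \<gamma> d (Suc j) \<le> \<gamma> d j"
    and "\<And>d. 1 \<le> d \<Longrightarrow> 0 < \<gamma> d d"
    and "\<And>d. 1 \<le> d \<Longrightarrow> banach_function_space (cube d) (F d) (nrm d)"
    and "\<And>d. 1 \<le> d \<Longrightarrow> F d \<subseteq> Linf d"
    and "0 \<le> c" and "0 \<le> q\<^sub>1"
    and "\<And>d. 1 \<le> d \<Longrightarrow>
           continuously_embedded (poly_space d) (poly_norm \<gamma> d) (F d) (nrm d)"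
    and "\<And>d. 1 \<le> d \<Longrightarrow>
           embedding_norm (poly_space d) (poly_norm \<gamma> d) (nrm d) \<le> c * real d powr q\<^sub>1"
  shows "(\<forall>d \<epsilon>. 1 \<le> d \<longrightarrow> 0 < \<epsilon> \<longrightarrow>
            \<epsilon> < inverse (embedding_norm (poly_space d) (poly_norm \<gamma> d) (nrm d)) \<longrightarrow>
            ereal (1 / 2 * 2 powr (1 / (2 + C\<^sub>\<gamma>) * (\<Sum>j=1..d. \<gamma> d j)))
              < ereal_of_enat (n_wor \<epsilon> d (F d) (nrm d)))
    \<and> (polynomially_tractable F nrm \<longrightarrow> sum_exp_q \<gamma> \<le> 1)
    \<and> (q\<^sub>1 = 0 \<and> strongly_polynomially_tractable F nrm \<longrightarrow> sum_exp_p \<gamma> \<le> 1)"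
proof -
  \<comment> \<open>Monotonicity spreads the conditions on the first and last generator to all of
    them.\<close>
  have \<gamma>_pos: "0 < \<gamma> d j" and \<gamma>_le: "\<gamma> d j \<le> C\<^sub>\<gamma>" if j: "1 \<le> j" "j \<le> d" for d j
  proof -
    have mono: "\<gamma> d k \<le> \<gamma> d i" if "1 \<le> i" "i \<le> k" "k \<le> d" for i k
      using that(2,3)
    proof (induction rule: dec_induct)
      case (step k)
      then show ?case using assms(2)[of k d] \<open>1 \<le> i\<close> by force
    qed simp
    show "0 < \<gamma> d j" using mono[of j d] assms(3)[of d] j by force
    show "\<gamma> d j \<le> C\<^sub>\<gamma>" using mono[of 1 j] assms(1)[of d] j by force
  qed
  define E where "E d = embedding_norm (poly_space d) (poly_norm \<gamma> d) (nrm d)" for d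
  have E_pos: "0 < E d" and lower: "\<And>\<epsilon>. 0 < \<epsilon> \<Longrightarrow> \<epsilon> < inverse (E d) \<Longrightarrow>
      ereal (1 / 2 * 2 powr (1 / (2 + C\<^sub>\<gamma>) * (\<Sum>j=1..d. \<gamma> d j))) < ereal_of_enat (n_wor \<epsilon> d (F d) (nrm d))"
    if d: "1 \<le> d" for d
    unfolding E_def using n_wor_lower_bound[OF d _ assms(4,5,8)[OF d], of C\<^sub>\<gamma>] \<gamma>_pos \<gamma>_le by auto
  have C_pos: "0 < 2 + C\<^sub>\<gamma>" using \<gamma>_pos[of 1 1] \<gamma>_le[of 1 1] by simp
  note bound = weight_sum_le_of_tractable[OF C_pos lower E_pos assms(9)[folded E_def] assms(7)]
  have "sum_exp_q \<gamma> \<le> 1" if tract: "polynomially_tractable F nrm"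
  proof -
    obtain q where "tractable_with_exponent F nrm q"
      using tract unfolding polynomially_tractable_def by blast
    from bound[OF _ _ _ _ _ this] obtain A B where "\<And>d. 1 \<le> d \<Longrightarrow> (\<Sum>j=1..d. \<gamma> d j) \<le> A + B * ln (real d)"
      by blast
    with \<gamma>_pos show ?thesis by (rule sum_exp_q_le_one)
  qed
  moreover have "sum_exp_p \<gamma> \<le> 1" if "q\<^sub>1 = 0" and tract: "strongly_polynomially_tractable F nrm"
  proof -
    have "tractable_with_exponent F nrm 0"
      using tract unfolding strongly_polynomially_tractable_def .
    \<comment> \<open>With both exponents 0 the logarithmic term disappears, and the bound is
      uniform in \<open>d\<close>.\<close>
    from bound[OF _ _ _ _ _ this] obtain A B where "B = 0" "\<And>d. 1 \<le> d \<Longrightarrow> (\<Sum>j=1..d. \<gamma> d j) \<le> A + B * ln (real d)"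
      using \<open>q\<^sub>1 = 0\<close> by blast
    then have "\<And>d. 1 \<le> d \<Longrightarrow> (\<Sum>j=1..d. \<gamma> d j) \<le> A" by simp
    with \<gamma>_pos show ?thesis by (rule sum_exp_p_le_one)
  qed
  ultimately show ?thesis using lower unfolding E_def by blast
qed

end
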